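(* If $\alpha=a/b\in\mathbb{Q}\cap(0,1]$ (with $a,b$ positive integers) and $p$ is a prime number congruent to $1$ modulo $b$, then the $q$-difference operator $$\mathcal{H}_{q,\alpha}=\sigma_q-\frac{1-z}{1-q^{\alpha}z}$$ has a strong Frobenius structure for $p$ with period $1$.
   Context: Fix a prime $p$ and a variable $q$. Let $\mathfrak{m}=(p,1-q)\subset\mathbb{Z}[q]$. For nonzero $x\in\mathbb{Z}[q]$ there is a unique integer $n\ge0$ with $x\in\mathfrak{m}^n\setminus\mathfrak{m}^{n+1}$; put $|x|_{\mathfrak{m}}=p^{-n}$, and $|0|_{\mathfrak{m}}=0$. This is a (multiplicative) ultrametric absolute value; it extends to $\mathbb{Q}(q)$. $\mathbb{Z}[q]_{\mathfrak{m}}$ is the localization of $\mathbb{Z}[q]$ at $\mathfrak{m}$, and $\mathbb{Z}_{q,p}$ is its completion for $|\cdot|_{\mathfrak{m}}$. $\mathbf{F}_q:\mathbb{Z}_{q,p}\to\mathbb{Z}_{q,p}$ is the continuous ring endomorphism extending $P(q)/Q(q)\mapsto P(q^p)/Q(q^p)$. For $\beta\in\mathbb{Z}_p$ with $p$-adic expansion $\beta=\sum_{n\ge0}s_np^n$, $s_n\in\{0,\ldots,p-1\}$, and $\beta_j=\sum_{n=0}^js_np^n$, one sets $q^\beta=q^{\beta_0}+\sum_{j\ge1}q^{\beta_{j-1}}(q^{s_jp^j}-1)=\lim_j q^{\beta_j}\in\mathbb{Z}_{q,p}$. (Under the hypothesis, $\alpha\in\mathbb{Z}_p$.) $\mathbb{Z}_{q,p}[[z]]$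 carries the Gauss norm $|\sum a_nz^n|_{\mathcal G}=\sup_n|a_n|_{\mathfrak{m}}$. Let $S=\{P(z)\in\mathbb{Z}_{q,p}[z]: |P(0)|_{\mathfrak{m}}=1\}$; $\mathbb{Z}_{q,p}[z]_S\subset\mathbb{Z}_{q,p}[[z]]$ is the localization of $\mathbb{Z}_{q,p}[z]$ at $S$, and $E_{\mathbb{Z},q,p}\subset\mathbb{Z}_{q,p}[[z]]$ is the completion of $\mathbb{Z}_{q,p}[z]_S$ for the Gauss norm. Put $\sigma_q(\sum a_nz^n)=\sum a_nq^nz^n$ and $\mathbf{F}_q(\sum a_nz^n)=\sum\mathbf{F}_q(a_n)z^{np}$; both preserve $E_{\mathbb{Z},q,p}$. An operator $L_q=\sigma_q^n+a_1(z)\sigma_q^{n-1}+\cdots+a_n(z)$ with $a_i\in E_{\mathbb{Z},q,p}$ and companion matrix $A_q$ (ones on the superdiagonal, last row $(-a_n,\ldots,-a_1)$, zeros elsewhere) has a strong Frobenius structure (for $p$) with period $h$ ($h>0$ an integer) if there is $H_q\in\mathrm{GL}_n(E_{\mathbb{Z},q,p})$ with $\sigma_q(H_q)A_q^{\mathbf{F}_q^h}=A_qH_q$, where $A_q^{\mathbf{F}_q^h}$ is obtained by applying $\mathbf{F}_q$ $h$ times to each entry of $A_q$. For $\mathcal{H}_{q,\alpha}$, $n=1$ and $A_q=\frac{1-z}{1-q^\alpha z}$. *)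

theory Defs
  imports
    Complex_Main
    "HOL-Computational_Algebra.Computational_Algebra"
    "HOL-Number_Theory.Cong"
    "Jordan_Normal_Form.Matrix"
    "Berlekamp_Zassenhaus.Finite_Field"
begin

hide_const (open) up_ring.coeff up_ring.monom Module.smult Module.module

text \<open>The polynomial ring \<open>\<int>[q]\<close> is \<^typ>\<open>int poly\<close>, with \<open>q = [:0, 1:]\<close>; its
  ideals are the submodules for multiplication, and \<open>zq_ideal.span\<close> is the generated ideal.\<close>

interpretation zq_ideal: Modules.module "(*) :: int poly \<Rightarrow> int poly \<Rightarrow> int poly"
  by standard (simp_all add: algebra_simps)

definition m_ideal :: "nat \<Rightarrow> int poly set" where
  "m_ideal p = zq_ideal.span {of_nat p, 1 - [:0, 1:]}"

primrec m_power :: "nat \<Rightarrow> nat \<Rightarrow> int poly set" where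
  "m_power p 0 = UNIV"
| "m_power p (Suc n) = zq_ideal.span {x * y |x y. x \<in> m_ideal p \<and> y \<in> m_power p n}"

declare m_power.simps(2) [simp del]

definition m_ord :: "nat \<Rightarrow> int poly \<Rightarrow> nat" where
  "m_ord p x = (THE n. x \<in> m_power p n - m_power p (Suc n))"

definition m_abs :: "nat \<Rightarrow> int poly \<Rightarrow> real" where
  "m_abs p x = (if x = 0 then 0 else (1 / real p) ^ m_ord p x)"

text \<open>The value does not depend on the chosen fraction, see \<open>m_abs_Fract\<close> below.\<close>

definition m_abs_fract :: "nat \<Rightarrow> int poly fract \<Rightarrow> real" where
  "m_abs_fract p x = (case quot_of_fract x of (P, Q) \<Rightarrow> m_abs p P / m_abs p Q)"

definition zq_local :: "nat \<Rightarrow> int poly fract set" where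
  "zq_local p = {Fraction_Field.Fract P Q |P Q. Q \<notin> m_ideal p}"

text \<open>Expansion in powers of \<open>q - 1\<close>: \<open>P\<close> lies in \<open>\<mm>\<^sup>n\<close> iff \<open>p ^ (n - i)\<close> divides the
  coefficient of \<open>(q - 1) ^ i\<close> for all \<open>i\<close>. This yields multiplicativity of the absolute value.\<close>

definition q_shift :: "int poly \<Rightarrow> int poly" where
  "q_shift P = pcompose P [:1, 1:]"

definition shift_power :: "nat \<Rightarrow> nat \<Rightarrow> int poly set" where
  "shift_power p n = {R. \<forall>i. int p ^ (n - i) dvd coeff R i}"

lemma q_shift_simps [simp]:
  "q_shift 0 = 0" "q_shift 1 = 1" "q_shift (P + Q) = q_shift P + q_shift Q"
  "q_shift (P - Q) = q_shift P - q_shift Q" "q_shift (P * Q) = q_shift P * q_shift Q"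
  by (simp_all add: q_shift_def pcompose_add pcompose_diff pcompose_mult pcompose_1)

lemma q_shift_unshift: "pcompose (q_shift P) [:-1, 1:] = P"
  by (simp add: q_shift_def pcompose_pCons pcompose_idR flip: pcompose_assoc)

lemma q_shift_eq_0_iff [simp]: "q_shift P = 0 \<longleftrightarrow> P = 0"
  by (metis q_shift_unshift q_shift_simps(1) pcompose_0)

lemma shift_power_mult:
  assumes "R \<in> shift_power p a" "S \<in> shift_power p b"
  shows "R * S \<in> shift_power p (a + b)"
  unfolding shift_power_def
proof safe
  fix i
  have "int p ^ (a + b - i) dvd coeff R j * coeff S (i - j)" if "j \<le> i" for j
  proof -
    have "int p ^ (a - j) * int p ^ (b - (i - j)) dvd coeff R j * coeff S (i - j)"
      using assms by (intro mult_dvd_mono) (auto simp: shift_power_def)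
    moreover have "int p ^ (a + b - i) dvd int p ^ (a - j) * int p ^ (b - (i - j))"
      unfolding power_add[symmetric] using that by (intro le_imp_power_dvd) linarith
    ultimately show ?thesis by (rule dvd_trans[rotated])
  qed
  then show "int p ^ (a + b - i) dvd coeff (R * S) i"
    unfolding coeff_mult by (intro dvd_sum) auto
qed

lemma shift_power_0 [simp]: "shift_power p 0 = UNIV"
  by (auto simp: shift_power_def)

lemma shift_power_mult_left: "R \<in> shift_power p a \<Longrightarrow> S * R \<in> shift_power p a"
  using shift_power_mult[of S p 0 R a] by simp

lemma zero_in_shift_power [simp]: "0 \<in> shift_power p n"
  by (simp add: shift_power_def)

lemma shift_power_add:
  "R \<in> shift_power p n \<Longrightarrow> S \<in> shift_power p n \<Longrightarrow> R + S \<in> shift_power p n"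
  by (simp add: shift_power_def)

lemma subspace_shift: "zq_ideal.subspace {P. q_shift P \<in> shift_power p n}"
  by (auto simp: zq_ideal.subspace_def shift_power_add shift_power_mult_left)

lemma m_ideal_subset: "m_ideal p \<subseteq> {P. q_shift P \<in> shift_power p 1}"
  unfolding m_ideal_def
proof (rule zq_ideal.span_minimal[OF _ subspace_shift], safe)
  have "q_shift (of_nat p) = of_nat p"
    by (simp add: q_shift_def of_nat_poly pcompose_const)
  then show "q_shift (of_nat p) \<in> shift_power p 1"
    by (auto simp: shift_power_def of_nat_poly coeff_pCons split: nat.split)
  have "q_shift (1 - [:0, 1:]) = [:0, -1:]"
    by (simp add: q_shift_def pcompose_diff pcompose_1 pcompose_pCons one_pCons)
  then show "q_shift (1 - [:0, 1:]) \<in> shift_power p 1"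
    by (auto simp: shift_power_def coeff_pCons split: nat.split)
qed

lemma m_power_subset: "m_power p n \<subseteq> {P. q_shift P \<in> shift_power p n}"
proof (induction n)
  case (Suc n)
  have "q_shift (x * y) \<in> shift_power p (Suc n)" if "x \<in> m_ideal p" "y \<in> m_power p n" for x y
    using shift_power_mult[of "q_shift x" p 1 "q_shift y" n] that m_ideal_subset Suc by auto
  then show ?case
    unfolding m_power.simps(2) by (intro zq_ideal.span_minimal[OF _ subspace_shift]) auto
qed simp

lemma m_power_mult_left: "x \<in> m_power p n \<Longrightarrow> y * x \<in> m_power p n"
  by (cases n) (auto simp: m_power.simps(2) intro: zq_ideal.span_scale)

lemma m_power_0_mem: "0 \<in> m_power p n"
  by (cases n) (auto simp: m_power.simps(2) intro: zq_ideal.span_zero)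

lemma m_power_add: "x \<in> m_power p n \<Longrightarrow> y \<in> m_power p n \<Longrightarrow> x + y \<in> m_power p n"
  by (cases n) (auto simp: m_power.simps(2) intro: zq_ideal.span_add)

lemma m_power_sum: "(\<And>i. i \<in> A \<Longrightarrow> f i \<in> m_power p n) \<Longrightarrow> sum f A \<in> m_power p n"
  by (induction A rule: infinite_finite_induct) (auto intro: m_power_0_mem m_power_add)

lemma m_power_Suc_subset: "m_power p (Suc n) \<subseteq> m_power p n"
proof -
  have "zq_ideal.subspace (m_power p n)"
    by (auto simp: zq_ideal.subspace_def m_power_0_mem m_power_add m_power_mult_left)
  then show ?thesis
    unfolding m_power.simps(2) by (intro zq_ideal.span_minimal) (auto intro: m_power_mult_left)
qed

lemma m_power_antimono: "n \<le> k \<Longrightarrow> m_power p k \<subseteq> m_power p n"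
  by (rule lift_Suc_antimono_le[of "m_power p"]) (use m_power_Suc_subset in auto)

lemma m_power_SucI: "x \<in> m_ideal p \<Longrightarrow> y \<in> m_power p n \<Longrightarrow> x * y \<in> m_power p (Suc n)"
  unfolding m_power.simps(2) by (rule zq_ideal.span_base) blast

lemma m_ideal_generators: "of_nat p \<in> m_ideal p" "1 - [:0, 1:] \<in> m_ideal p"
  unfolding m_ideal_def by (rule zq_ideal.span_base; blast)+

lemma m_power_generator: "of_nat p ^ a * (1 - [:0, 1:]) ^ b \<in> m_power p (a + b)"
proof (induction a)
  case 0
  have "(1 - [:0, 1:]) ^ b \<in> m_power p b"
  proof (induction b)
    case (Suc b)
    then show ?case unfolding power_Suc by (intro m_power_SucI m_ideal_generators)
  qed simp
  then show ?case by simp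
next
  case (Suc a)
  then show ?case
    unfolding power_Suc add_Suc mult.assoc by (intro m_power_SucI m_ideal_generators)
qed

lemma m_power_iff: "P \<in> m_power p n \<longleftrightarrow> q_shift P \<in> shift_power p n"
proof
  assume *: "q_shift P \<in> shift_power p n"
  define R where "R = q_shift P"
  have "P = pcompose R [:-1, 1:]" by (simp add: R_def q_shift_unshift)
  also have "\<dots> = (\<Sum>i\<le>degree R. smult (coeff R i) ([:-1, 1:] ^ i))"
    by (simp add: pcompose_altdef poly_altdef coeff_map_poly degree_map_poly)
  also have "\<dots> \<in> m_power p n"
  proof (rule m_power_sum)
    fix i
    have "int p ^ (n - i) dvd coeff R i" using * by (simp add: R_def shift_power_def)
    then obtain c where c: "coeff R i = int p ^ (n - i) * c" by (elim dvdE)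
    have e: "[:-1, 1:] = - (1 - [:0, 1 :: int:])" by (simp add: one_pCons)
    have "smult (coeff R i) ([:-1, 1:] ^ i) =
        [:c * (-1) ^ i:] * (of_nat p ^ (n - i) * (1 - [:0, 1:]) ^ i)"
      by (simp only: e power_minus[of "1 - [:0, 1 :: int:]"])
         (cases "even i"; simp add: c of_nat_poly poly_const_pow algebra_simps)
    also have "\<dots> \<in> m_power p n"
      by (intro m_power_mult_left
          m_power_antimono[of n "n - i + i" p, THEN subsetD, OF _ m_power_generator[of p "n - i" i]])
         simp
    finally show "smult (coeff R i) ([:-1, 1:] ^ i) \<in> m_power p n" .
  qed
  finally show "P \<in> m_power p n" .
qed (use m_power_subset in auto)

lemma m_power_1: "m_power p 1 = m_ideal p"
proof -
  have "x \<in> m_ideal p" if "x \<in> zq_ideal.span {x * y |x y. x \<in> m_ideal p}" for x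
    using that
  proof (rule zq_ideal.span_minimal[THEN subsetD, rotated -1])
    show "{x * y |x y. x \<in> m_ideal p} \<subseteq> m_ideal p"
      unfolding m_ideal_def using zq_ideal.span_scale by (auto simp: mult.commute)
  qed (simp add: m_ideal_def)
  moreover have "x \<in> zq_ideal.span {x * y |x y. x \<in> m_ideal p}" if "x \<in> m_ideal p" for x
  proof (rule zq_ideal.span_base)
    have "x = x * 1" by simp
    with that show "x \<in> {x * y |x y. x \<in> m_ideal p}" by blast
  qed
  moreover have "m_power p 1 = zq_ideal.span {x * y |x y. x \<in> m_ideal p}"
    by (simp add: m_power.simps(2))
  ultimately show ?thesis by blast
qed

lemma m_ideal_iff: "P \<in> m_ideal p \<longleftrightarrow> int p dvd poly P 1"
proof -
  have "poly P 1 = coeff (q_shift P) 0"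
    by (simp add: q_shift_def poly_pcompose flip: poly_0_coeff_0)
  moreover have "(\<forall>i. int p ^ (1 - i) dvd coeff R i) \<longleftrightarrow> int p dvd coeff R 0" for R :: "int poly"
  proof safe
    fix i assume "int p dvd coeff R 0"
    then show "int p ^ (1 - i) dvd coeff R i" by (cases i) auto
  next
    assume "\<forall>i. int p ^ (1 - i) dvd coeff R i"
    from this[rule_format, of 0] show "int p dvd coeff R 0" by simp
  qed
  ultimately show ?thesis
    unfolding m_power_1[symmetric] m_power_iff shift_power_def mem_Collect_eq by simp
qed

lemma m_power_bounded:
  assumes "P \<noteq> 0" "p > 1"
  shows "\<exists>n. P \<notin> m_power p n"
proof -
  define c where "c = coeff (q_shift P) (degree (q_shift P))"
  have "c \<noteq> 0" using assms by (simp add: c_def)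
  have "P \<notin> m_power p (nat \<bar>c\<bar> + degree (q_shift P))"
  proof
    assume "P \<in> m_power p (nat \<bar>c\<bar> + degree (q_shift P))"
    then have "int p ^ (nat \<bar>c\<bar> + degree (q_shift P) - degree (q_shift P)) dvd c"
      by (simp only: m_power_iff shift_power_def c_def mem_Collect_eq)
    then have "int p ^ nat \<bar>c\<bar> dvd c" by simp
    then have "\<bar>int p ^ nat \<bar>c\<bar>\<bar> \<le> \<bar>c\<bar>"
      using \<open>c \<noteq> 0\<close> by (rule dvd_imp_le_int[rotated])
    then have "int p ^ nat \<bar>c\<bar> \<le> \<bar>c\<bar>" by simp
    moreover have "nat \<bar>c\<bar> < p ^ nat \<bar>c\<bar>"
      using assms by (intro power_gt_expt) auto
    then have "int (nat \<bar>c\<bar>) < int p ^ nat \<bar>c\<bar>" by (metis of_nat_less_iff of_nat_power)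
    ultimately show False by simp
  qed
  then show ?thesis ..
qed

lemma m_ord_unique:
  assumes "P \<noteq> 0" "p > 1"
  shows "\<exists>!n. P \<in> m_power p n - m_power p (Suc n)"
proof -
  define n where "n = (LEAST n. P \<notin> m_power p n)"
  have 1: "P \<notin> m_power p n"
    unfolding n_def using m_power_bounded[OF assms] by (rule LeastI_ex)
  then obtain k where k: "n = Suc k" by (cases n) auto
  have 2: "P \<in> m_power p k"
    using not_less_Least[of k "\<lambda>n. P \<notin> m_power p n"] k by (auto simp: n_def)
  show ?thesis
  proof (rule ex1I[of _ k])
    show "P \<in> m_power p k - m_power p (Suc k)" using 1 2 k by auto
    fix j assume j: "P \<in> m_power p j - m_power p (Suc j)"
    show "j = k"
    proof (rule ccontr)
      assume "j \<noteq> k"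
      then have "Suc j \<le> k \<or> Suc k \<le> j" by auto
      then show False using m_power_antimono[of "Suc j" k p] m_power_antimono[of "Suc k" j p] j 1 2 k
        by auto
    qed
  qed
qed

lemma m_ord_eqI:
  "P \<in> m_power p n \<Longrightarrow> P \<notin> m_power p (Suc n) \<Longrightarrow> P \<noteq> 0 \<Longrightarrow> p > 1 \<Longrightarrow> m_ord p P = n"
  unfolding m_ord_def by (rule the1_equality[OF m_ord_unique]) auto

lemma m_ord_mem:
  assumes "P \<noteq> 0" "p > 1"
  shows "P \<in> m_power p (m_ord p P)" "P \<notin> m_power p (Suc (m_ord p P))"
  using theI'[OF m_ord_unique[OF assms]] by (auto simp: m_ord_def)

lemma m_power_iff_ord:
  assumes "P \<noteq> 0" "p > 1"
  shows "P \<in> m_power p n \<longleftrightarrow> n \<le> m_ord p P"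
  using m_ord_mem[OF assms] m_power_antimono[of n "m_ord p P" p]
    m_power_antimono[of "Suc (m_ord p P)" n p] by (cases "n \<le> m_ord p P") auto

lemma shift_power_mult_exact:
  assumes p: "prime p"
    and R: "R \<in> shift_power p a" "R \<notin> shift_power p (Suc a)"
    and S: "S \<in> shift_power p b" "S \<notin> shift_power p (Suc b)"
  shows "R * S \<notin> shift_power p (Suc (a + b))"
proof
  assume *: "R * S \<in> shift_power p (Suc (a + b))"
  define i where "i = (LEAST i. \<not> int p ^ (Suc a - i) dvd coeff R i)"
  define j where "j = (LEAST j. \<not> int p ^ (Suc b - j) dvd coeff S j)"
  have i: "\<not> int p ^ (Suc a - i) dvd coeff R i"
    unfolding i_def using R(2) by (intro LeastI_ex[of "\<lambda>i. \<not> int p ^ (Suc a - i) dvd coeff R i"])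
      (simp add: shift_power_def)
  have j: "\<not> int p ^ (Suc b - j) dvd coeff S j"
    unfolding j_def using S(2) by (intro LeastI_ex[of "\<lambda>j. \<not> int p ^ (Suc b - j) dvd coeff S j"])
      (simp add: shift_power_def)
  have i': "int p ^ (Suc a - k) dvd coeff R k" if "k < i" for k
    using not_less_Least[of k "\<lambda>i. \<not> int p ^ (Suc a - i) dvd coeff R i"] that by (auto simp: i_def)
  have j': "int p ^ (Suc b - k) dvd coeff S k" if "k < j" for k
    using not_less_Least[of k "\<lambda>j. \<not> int p ^ (Suc b - j) dvd coeff S j"] that by (auto simp: j_def)
  have "i \<le> a" using i by (cases "i \<le> a") auto
  have "j \<le> b" using j by (cases "j \<le> b") auto
  define N where "N = Suc (a + b) - (i + j)"
  have other: "int p ^ N dvd coeff R k * coeff S (i + j - k)" if "k \<le> i + j" "k \<noteq> i" for k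
  proof (cases "k < i")
    case True
    have "int p ^ (Suc a - k) * int p ^ (b - (i + j - k)) dvd coeff R k * coeff S (i + j - k)"
      using S(1) by (intro mult_dvd_mono i'[OF True]) (auto simp: shift_power_def)
    moreover have "int p ^ N dvd int p ^ (Suc a - k) * int p ^ (b - (i + j - k))"
      unfolding power_add[symmetric] N_def using True \<open>i \<le> a\<close> by (intro le_imp_power_dvd) linarith
    ultimately show ?thesis by (rule dvd_trans[rotated])
  next
    case False
    then have lt: "i + j - k < j" using that by linarith
    have "int p ^ (a - k) * int p ^ (Suc b - (i + j - k)) dvd coeff R k * coeff S (i + j - k)"
      using R(1) by (intro mult_dvd_mono j'[OF lt]) (auto simp: shift_power_def)
    moreover have "int p ^ N dvd int p ^ (a - k) * int p ^ (Suc b - (i + j - k))"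
      unfolding power_add[symmetric] N_def using that lt \<open>j \<le> b\<close>
      by (intro le_imp_power_dvd) linarith
    ultimately show ?thesis by (rule dvd_trans[rotated])
  qed
  have "int p ^ N dvd coeff (R * S) (i + j)" using * by (simp add: shift_power_def N_def)
  also have "coeff (R * S) (i + j) =
      coeff R i * coeff S j + (\<Sum>k\<in>{..i + j} - {i}. coeff R k * coeff S (i + j - k))"
    unfolding coeff_mult by (subst sum.remove[of _ i]) auto
  finally have "int p ^ N dvd coeff R i * coeff S j"
    using other by (subst (asm) dvd_add_left_iff) (auto intro!: dvd_sum)
  moreover obtain c where c: "coeff R i = int p ^ (a - i) * c"
    using R(1) by (auto simp: shift_power_def elim!: allE[of _ i] elim: dvdE)
  moreover obtain d where d: "coeff S j = int p ^ (b - j) * d"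
    using S(1) by (auto simp: shift_power_def elim!: allE[of _ j] elim: dvdE)
  moreover have "int p ^ N = int p ^ (a - i) * int p ^ (b - j) * int p"
  proof -
    have "N = Suc ((a - i) + (b - j))" using \<open>i \<le> a\<close> \<open>j \<le> b\<close> by (simp add: N_def)
    then show ?thesis by (simp only: power_Suc2 power_add)
  qed
  ultimately have "int p dvd c * d"
    using p by (auto simp: mult_ac dest: prime_gt_0_nat)
  then have "int p dvd c \<or> int p dvd d"
    using p by (simp add: prime_dvd_mult_iff)
  moreover have "\<not> int p dvd c"
    using i \<open>i \<le> a\<close> by (auto simp: c Suc_diff_le mult_ac)
  moreover have "\<not> int p dvd d"
    using j \<open>j \<le> b\<close> by (auto simp: d Suc_diff_le mult_ac)
  ultimately show False by blast
qed

lemma m_ord_mult: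
  assumes "prime p" "P \<noteq> 0" "Q \<noteq> 0"
  shows "m_ord p (P * Q) = m_ord p P + m_ord p Q"
proof -
  have p: "p > 1" using assms(1) by (rule prime_gt_1_nat)
  show ?thesis
  proof (rule m_ord_eqI)
    show "P * Q \<in> m_power p (m_ord p P + m_ord p Q)"
      using m_ord_mem[of P p] m_ord_mem[of Q p] assms p by (auto simp: m_power_iff shift_power_mult)
    show "P * Q \<notin> m_power p (Suc (m_ord p P + m_ord p Q))"
      using m_ord_mem[of P p] m_ord_mem[of Q p] assms p shift_power_mult_exact
      by (simp only: m_power_iff q_shift_simps) blast
  qed (use assms p in auto)
qed

lemma m_abs_mult: "prime p \<Longrightarrow> m_abs p (P * Q) = m_abs p P * m_abs p Q"
  by (auto simp: m_abs_def m_ord_mult power_add)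

lemma m_abs_le_iff:
  assumes "p > 1"
  shows "m_abs p P \<le> (1 / real p) ^ n \<longleftrightarrow> P \<in> m_power p n"
proof (cases "P = 0")
  case False
  have "(1 / real p) ^ m_ord p P \<le> (1 / real p) ^ n \<longleftrightarrow> n \<le> m_ord p P"
    using assms by (intro power_decreasing_iff) auto
  then show ?thesis using False m_power_iff_ord[OF False assms] by (simp add: m_abs_def)
qed (use assms m_power_0_mem in \<open>auto simp: m_abs_def\<close>)

lemma m_abs_nonneg [simp]: "m_abs p P \<ge> 0"
  by (simp add: m_abs_def)

lemma m_abs_eq_0_iff [simp]: "p > 0 \<Longrightarrow> m_abs p P = 0 \<longleftrightarrow> P = 0"
  by (simp add: m_abs_def)

lemma m_abs_0 [simp]: "m_abs p 0 = 0"
  by (simp add: m_abs_def)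

lemma m_abs_ultrametric:
  assumes "p > 1"
  shows "m_abs p (P + Q) \<le> max (m_abs p P) (m_abs p Q)"
proof (cases "P = 0 \<or> Q = 0")
  case False
  have *: "m_abs p (P + Q) \<le> (1 / real p) ^ min (m_ord p P) (m_ord p Q)"
    unfolding m_abs_le_iff[OF assms]
    using False assms by (intro m_power_add) (auto simp: m_power_iff_ord)
  show ?thesis
    by (cases "m_ord p P \<le> m_ord p Q") (use * False in \<open>auto simp: m_abs_def min_def\<close>)
qed auto

lemma m_abs_minus [simp]:
  assumes "p > 1"
  shows "m_abs p (- P) = m_abs p P"
proof -
  have "- P \<in> m_power p n \<longleftrightarrow> P \<in> m_power p n" for n
    using m_power_mult_left[of P p n "-1"] m_power_mult_left[of "- P" p n "-1"] by auto
  then show ?thesis by (simp add: m_abs_def m_ord_def)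
qed

lemma m_abs_eq_1_iff:
  assumes "p > 1"
  shows "m_abs p P = 1 \<longleftrightarrow> P \<notin> m_ideal p"
proof (cases "P = 0")
  case False
  have "P \<in> m_ideal p \<longleftrightarrow> m_ord p P \<ge> 1"
    using m_power_iff_ord[OF False assms, of 1] by (simp only: m_power_1)
  then show ?thesis
    using False assms power_strict_decreasing[of 0 "m_ord p P" "1 / real p"]
    by (cases "m_ord p P = 0") (auto simp: m_abs_def)
qed (auto simp: m_ideal_iff)

lemma m_abs_le_1: "p > 1 \<Longrightarrow> m_abs p P \<le> 1"
  using m_abs_le_iff[of p P 0] by simp

lemma m_abs_Fract:
  assumes "prime p" "Q \<noteq> 0"
  shows "m_abs_fract p (Fraction_Field.Fract P Q) = m_abs p P / m_abs p Q"
proof -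
  obtain P' Q' where *: "quot_of_fract (Fraction_Field.Fract P Q) = (P', Q')"
    by (cases "quot_of_fract (Fraction_Field.Fract P Q)")
  have "Q' \<noteq> 0" using snd_quot_of_fract_nonzero[of "Fraction_Field.Fract P Q"] * by simp
  have "Fraction_Field.Fract P Q = Fraction_Field.Fract P' Q'"
    by (metis * Fract_quot_of_fract fst_conv snd_conv)
  then have "P * Q' = P' * Q"
    using \<open>Q' \<noteq> 0\<close> assms by (simp add: eq_fract)
  then have "m_abs p P * m_abs p Q' = m_abs p P' * m_abs p Q"
    by (metis m_abs_mult assms(1))
  moreover have "m_abs p Q \<noteq> 0" "m_abs p Q' \<noteq> 0"
    using assms \<open>Q' \<noteq> 0\<close> by (auto simp: prime_gt_0_nat)
  ultimately show ?thesis by (simp add: m_abs_fract_def * field_simps)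
qed

lemma m_abs_fract_0 [simp]: "prime p \<Longrightarrow> m_abs_fract p 0 = 0"
  by (simp add: Zero_fract_def m_abs_Fract)

lemma m_abs_fract_nonneg [simp]: "m_abs_fract p x \<ge> 0"
  by (simp add: m_abs_fract_def split: prod.split)

lemma m_abs_fract_eq_0_iff:
  assumes "prime p"
  shows "m_abs_fract p x = 0 \<longleftrightarrow> x = 0"
  by (cases x) (use assms in \<open>auto simp: m_abs_Fract prime_gt_0_nat Zero_fract_def eq_fract\<close>)

lemma m_abs_fract_mult:
  assumes "prime p"
  shows "m_abs_fract p (x * y) = m_abs_fract p x * m_abs_fract p y"
  by (cases x; cases y) (use assms in \<open>simp add: m_abs_Fract m_abs_mult\<close>)

lemma m_abs_fract_minus:
  assumes "prime p"
  shows "m_abs_fract p (- x) = m_abs_fract p x"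
  by (cases x) (use assms prime_gt_1_nat[OF assms] in \<open>simp add: m_abs_Fract\<close>)

lemma m_abs_fract_ultrametric:
  assumes "prime p"
  shows "m_abs_fract p (x + y) \<le> max (m_abs_fract p x) (m_abs_fract p y)"
proof (cases x; cases y)
  fix P Q R S :: "int poly"
  assume x: "x = Fraction_Field.Fract P Q" "Q \<noteq> 0" and y: "y = Fraction_Field.Fract R S" "S \<noteq> 0"
  have pos: "m_abs p Q > 0" "m_abs p S > 0"
    using x y m_abs_eq_0_iff[of p] m_abs_nonneg[of p] prime_gt_0_nat[OF assms]
    by (metis less_eq_real_def)+
  have "m_abs p (P * S + R * Q) \<le> max (m_abs p P * m_abs p S) (m_abs p R * m_abs p Q)"
    using m_abs_ultrametric[of p "P * S" "R * Q"] assms prime_gt_1_nat[OF assms] by (simp add: m_abs_mult)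
  then have "m_abs p (P * S + R * Q) / (m_abs p Q * m_abs p S) \<le>
      max (m_abs p P * m_abs p S) (m_abs p R * m_abs p Q) / (m_abs p Q * m_abs p S)"
    using pos by (intro divide_right_mono) auto
  also have "\<dots> = max (m_abs p P / m_abs p Q) (m_abs p R / m_abs p S)"
    using pos by (auto simp: max_def field_simps)
  finally show ?thesis
    using x y assms by (simp add: m_abs_Fract m_abs_mult)
qed

lemma m_abs_fract_triangle:
  assumes "prime p"
  shows "m_abs_fract p (x + y) \<le> m_abs_fract p x + m_abs_fract p y"
  using m_abs_fract_ultrametric[OF assms, of x y] m_abs_fract_nonneg[of p x] m_abs_fract_nonneg[of p y]
  by linarith

lemma m_abs_fract_diff_commute:
  "prime p \<Longrightarrow> m_abs_fract p (x - y) = m_abs_fract p (y - x)"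
  using m_abs_fract_minus[of p "x - y"] by simp

lemma m_abs_fract_triangle_diff:
  assumes "prime p"
  shows "\<bar>m_abs_fract p x - m_abs_fract p y\<bar> \<le> m_abs_fract p (x - y)"
  using m_abs_fract_triangle[OF assms, of "x - y" y] m_abs_fract_triangle[OF assms, of "y - x" x]
    m_abs_fract_diff_commute[OF assms, of x y] by auto

lemma zq_localE:
  assumes "x \<in> zq_local p"
  obtains P Q where "x = Fraction_Field.Fract P Q" "Q \<notin> m_ideal p" "Q \<noteq> 0"
proof -
  obtain P Q where *: "x = Fraction_Field.Fract P Q" "Q \<notin> m_ideal p"
    using assms by (auto simp: zq_local_def)
  moreover from * have "Q \<noteq> 0" by (auto simp: m_ideal_iff)
  ultimately show ?thesis by (rule that)
qed

lemma zq_local_Fract: "Q \<notin> m_ideal p \<Longrightarrow> Fraction_Field.Fract P Q \<in> zq_local p"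
  by (auto simp: zq_local_def)

lemma m_ideal_mult_iff: "prime p \<Longrightarrow> P * Q \<in> m_ideal p \<longleftrightarrow> P \<in> m_ideal p \<or> Q \<in> m_ideal p"
  by (simp add: m_ideal_iff prime_dvd_mult_iff)

lemma zq_local_closed:
  assumes "prime p" "x \<in> zq_local p" "y \<in> zq_local p"
  shows "x + y \<in> zq_local p" "x - y \<in> zq_local p" "x * y \<in> zq_local p" "- x \<in> zq_local p"
  using assms(2,3) by (auto elim!: zq_localE intro!: zq_local_Fract simp: m_ideal_mult_iff[OF assms(1)])

lemma zq_local_of_poly: "p > 1 \<Longrightarrow> to_fract P \<in> zq_local p"
  by (auto simp: to_fract_def m_ideal_iff intro!: zq_local_Fract)

lemma zq_local_0_1: "p > 1 \<Longrightarrow> 0 \<in> zq_local p" "p > 1 \<Longrightarrow> 1 \<in> zq_local p"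
  using zq_local_of_poly[of p 0] zq_local_of_poly[of p 1] by auto

lemma m_abs_local_Fract:
  assumes "prime p" "Q \<notin> m_ideal p"
  shows "m_abs_fract p (Fraction_Field.Fract P Q) = m_abs p P"
proof -
  have "Q \<noteq> 0" using assms by (auto simp: m_ideal_iff)
  moreover have "m_abs p Q = 1"
    using assms(2) m_abs_eq_1_iff[OF prime_gt_1_nat[OF assms(1)]] by blast
  ultimately show ?thesis using assms by (simp add: m_abs_Fract)
qed

lemma m_abs_fract_le_1: "prime p \<Longrightarrow> x \<in> zq_local p \<Longrightarrow> m_abs_fract p x \<le> 1"
  by (elim zq_localE) (simp add: m_abs_local_Fract m_abs_le_1 prime_gt_Suc_0_nat)

definition q_frob_fract :: "nat \<Rightarrow> int poly fract \<Rightarrow> int poly fract" where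
  "q_frob_fract p x = (case quot_of_fract x of (P, Q) \<Rightarrow>
     Fraction_Field.Fract (pcompose P ([:0, 1:] ^ p)) (pcompose Q ([:0, 1:] ^ p)))"

lemma pcompose_q_power_eq_0_iff:
  assumes "p > 0"
  shows "pcompose P ([:0, 1:] ^ p) = 0 \<longleftrightarrow> (P :: int poly) = 0"
  using assms by (subst pcompose_eq_0_iff) (auto simp: degree_power_eq)

lemma q_frob_Fract:
  assumes "p > 0" "Q \<noteq> 0"
  shows "q_frob_fract p (Fraction_Field.Fract P Q) =
    Fraction_Field.Fract (pcompose P ([:0, 1:] ^ p)) (pcompose Q ([:0, 1:] ^ p))"
proof -
  obtain P' Q' where *: "quot_of_fract (Fraction_Field.Fract P Q) = (P', Q')"
    by (cases "quot_of_fract (Fraction_Field.Fract P Q)")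
  have "Q' \<noteq> 0" using snd_quot_of_fract_nonzero[of "Fraction_Field.Fract P Q"] * by simp
  have "Fraction_Field.Fract P Q = Fraction_Field.Fract P' Q'"
    by (metis * Fract_quot_of_fract fst_conv snd_conv)
  then have "P * Q' = P' * Q"
    using \<open>Q' \<noteq> 0\<close> assms by (simp add: eq_fract)
  then have "pcompose P' ([:0, 1:] ^ p) * pcompose Q ([:0, 1:] ^ p) =
      pcompose P ([:0, 1:] ^ p) * pcompose Q' ([:0, 1:] ^ p)"
    by (metis pcompose_mult)
  then show ?thesis
    using assms \<open>Q' \<noteq> 0\<close> by (simp add: q_frob_fract_def * eq_fract pcompose_q_power_eq_0_iff)
qed

lemma q_frob_fract_hom:
  assumes "p > 0"
  shows "q_frob_fract p (x + y) = q_frob_fract p x + q_frob_fract p y"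
    "q_frob_fract p (x * y) = q_frob_fract p x * q_frob_fract p y"
    "q_frob_fract p (x - y) = q_frob_fract p x - q_frob_fract p y"
  by (cases x; cases y; use assms in \<open>simp add: q_frob_Fract pcompose_mult pcompose_add
      pcompose_diff pcompose_q_power_eq_0_iff\<close>)+

lemma q_frob_fract_of_poly:
  "p > 0 \<Longrightarrow> q_frob_fract p (to_fract P) = to_fract (pcompose P ([:0, 1:] ^ p))"
  by (simp add: to_fract_def q_frob_Fract pcompose_1)

lemma pcompose_q_power_m_power:
  "P \<in> m_power p n \<Longrightarrow> pcompose P ([:0, 1:] ^ p) \<in> m_power p n"
proof (induction n arbitrary: P)
  case (Suc n)
  let ?f = "\<lambda>P :: int poly. pcompose P ([:0, 1:] ^ p)"
  have sub: "zq_ideal.subspace {P. ?f P \<in> m_power p k}" for k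
    by (auto simp: zq_ideal.subspace_def m_power_0_mem pcompose_add pcompose_mult
        intro: m_power_add m_power_mult_left)
  have m: "?f x \<in> m_ideal p" if "x \<in> m_ideal p" for x
    using that by (simp add: m_ideal_iff poly_pcompose)
  have "{x * y |x y. x \<in> m_ideal p \<and> y \<in> m_power p n} \<subseteq> {P. ?f P \<in> m_power p (Suc n)}"
    using Suc.IH m by (auto simp: pcompose_mult intro!: m_power_SucI)
  from zq_ideal.span_minimal[OF this sub] Suc.prems show ?case
    by (auto simp: m_power.simps(2))
qed simp

lemma q_frob_local: "p > 0 \<Longrightarrow> x \<in> zq_local p \<Longrightarrow> q_frob_fract p x \<in> zq_local p"
  by (elim zq_localE) (auto simp: q_frob_Fract m_ideal_iff poly_pcompose intro!: zq_local_Fract)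

lemma m_abs_frob_le:
  assumes "prime p" "x \<in> zq_local p"
  shows "m_abs_fract p (q_frob_fract p x) \<le> m_abs_fract p x"
proof -
  have p: "p > 0" "p > 1" using assms by (simp_all add: prime_gt_0_nat prime_gt_Suc_0_nat)
  obtain P Q where PQ: "x = Fraction_Field.Fract P Q" "Q \<notin> m_ideal p" "Q \<noteq> 0"
    using assms(2) by (rule zq_localE)
  have Q': "pcompose Q ([:0, 1:] ^ p) \<notin> m_ideal p"
    using PQ(2) by (simp add: m_ideal_iff poly_pcompose)
  have "m_abs p (pcompose P ([:0, 1:] ^ p)) \<le> m_abs p P"
  proof (cases "P = 0")
    case False
    then have "m_abs p (pcompose P ([:0, 1:] ^ p)) \<le> (1 / real p) ^ m_ord p P"
      unfolding m_abs_le_iff[OF p(2)]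
      using m_ord_mem(1)[OF False p(2)] by (rule_tac pcompose_q_power_m_power)
    then show ?thesis using False by (simp add: m_abs_def)
  qed simp
  then show ?thesis
    using PQ Q' assms(1) p by (simp add: q_frob_Fract m_abs_local_Fract)
qed

definition zq_cauchy :: "nat \<Rightarrow> (nat \<Rightarrow> int poly fract) \<Rightarrow> bool" where
  "zq_cauchy p X \<longleftrightarrow> range X \<subseteq> zq_local p \<and>
     (\<forall>e>0. \<exists>M. \<forall>m\<ge>M. \<forall>n\<ge>M. m_abs_fract p (X m - X n) < e)"

lemma zq_cauchyI:
  assumes "\<And>n. X n \<in> zq_local p"
    and "\<And>e. e > 0 \<Longrightarrow> \<exists>M. \<forall>m\<ge>M. \<forall>n\<ge>M. m_abs_fract p (X m - X n) < e"
  shows "zq_cauchy p X"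
  using assms by (auto simp: zq_cauchy_def)

lemma zq_cauchyD:
  "zq_cauchy p X \<Longrightarrow> e > 0 \<Longrightarrow> \<exists>M. \<forall>m\<ge>M. \<forall>n\<ge>M. m_abs_fract p (X m - X n) < e"
  by (auto simp: zq_cauchy_def)

lemma zq_cauchy_local: "zq_cauchy p X \<Longrightarrow> X n \<in> zq_local p"
  by (auto simp: zq_cauchy_def)

lemma zq_cauchy_const: "prime p \<Longrightarrow> x \<in> zq_local p \<Longrightarrow> zq_cauchy p (\<lambda>_. x)"
  by (auto simp: zq_cauchy_def)

lemma zq_cauchy_bound:
  assumes X: "zq_cauchy p X" and Y: "zq_cauchy p Y" and Z: "\<And>n. Z n \<in> zq_local p"
    and le: "\<And>m n. m_abs_fract p (Z m - Z n) \<le>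
      max (m_abs_fract p (X m - X n)) (m_abs_fract p (Y m - Y n))"
  shows "zq_cauchy p Z"
proof (rule zq_cauchyI[OF Z])
  fix e :: real assume "e > 0"
  obtain M where M: "\<forall>m\<ge>M. \<forall>n\<ge>M. m_abs_fract p (X m - X n) < e"
    using zq_cauchyD[OF X \<open>e > 0\<close>] by blast
  obtain N where N: "\<forall>m\<ge>N. \<forall>n\<ge>N. m_abs_fract p (Y m - Y n) < e"
    using zq_cauchyD[OF Y \<open>e > 0\<close>] by blast
  have "m_abs_fract p (Z m - Z n) < e" if "m \<ge> max M N" "n \<ge> max M N" for m n
    using le[of m n] M N that by (meson le_less_trans max.bounded_iff max_less_iff_conj)
  then show "\<exists>M. \<forall>m\<ge>M. \<forall>n\<ge>M. m_abs_fract p (Z m - Z n) < e" by blast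
qed

lemma m_abs_fract_mult_diff_le:
  assumes "prime p" "x \<in> zq_local p" "y' \<in> zq_local p"
  shows "m_abs_fract p (x * y - x' * y') \<le> max (m_abs_fract p (x - x')) (m_abs_fract p (y - y'))"
proof -
  have "x * y - x' * y' = (x - x') * y' + x * (y - y')" by (simp add: algebra_simps)
  then have "m_abs_fract p (x * y - x' * y') \<le>
      max (m_abs_fract p (x - x') * m_abs_fract p y') (m_abs_fract p x * m_abs_fract p (y - y'))"
    using m_abs_fract_ultrametric[OF assms(1), of "(x - x') * y'" "x * (y - y')"]
    by (simp add: m_abs_fract_mult assms(1))
  also have "\<dots> \<le> max (m_abs_fract p (x - x')) (m_abs_fract p (y - y'))"
    using assms by (intro max.mono mult_left_le mult_left_le_one_le) (auto simp: m_abs_fract_le_1)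
  finally show ?thesis .
qed

lemma m_abs_fract_add_diff_le:
  assumes "prime p"
  shows "m_abs_fract p ((x + y) - (x' + y')) \<le> max (m_abs_fract p (x - x')) (m_abs_fract p (y - y'))"
  using m_abs_fract_ultrametric[OF assms, of "x - x'" "y - y'"] by (simp add: algebra_simps)

lemma m_abs_fract_minus_diff:
  assumes "prime p"
  shows "m_abs_fract p ((- x) - (- x')) = m_abs_fract p (x - x')"
  using m_abs_fract_minus[OF assms, of "x - x'"] by simp

lemma m_abs_fract_diff_diff_le:
  assumes "prime p"
  shows "m_abs_fract p ((x - y) - (x' - y')) \<le> max (m_abs_fract p (x - x')) (m_abs_fract p (y - y'))"
  using m_abs_fract_add_diff_le[OF assms, of x "- y" x' "- y'"] m_abs_fract_minus_diff[OF assms, of y y']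
  by simp

lemma zq_cauchy_closed:
  assumes "prime p" "zq_cauchy p X" "zq_cauchy p Y"
  shows "zq_cauchy p (\<lambda>n. X n + Y n)" "zq_cauchy p (\<lambda>n. X n - Y n)"
    "zq_cauchy p (\<lambda>n. X n * Y n)" "zq_cauchy p (\<lambda>n. - X n)"
proof -
  note * = assms(1) zq_cauchy_local[OF assms(2)] zq_cauchy_local[OF assms(3)]
  show "zq_cauchy p (\<lambda>n. X n + Y n)"
    by (rule zq_cauchy_bound[OF assms(2,3)]) (use * in \<open>auto intro: zq_local_closed m_abs_fract_add_diff_le\<close>)
  show "zq_cauchy p (\<lambda>n. X n - Y n)"
    by (rule zq_cauchy_bound[OF assms(2,3)]) (use * in \<open>auto intro: zq_local_closed m_abs_fract_diff_diff_le\<close>)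
  show "zq_cauchy p (\<lambda>n. X n * Y n)"
    by (rule zq_cauchy_bound[OF assms(2,3)])
      (use * m_abs_fract_mult_diff_le[OF assms(1)] in \<open>auto intro: zq_local_closed(3)\<close>)
  show "zq_cauchy p (\<lambda>n. - X n)"
    by (rule zq_cauchy_bound[OF assms(2,2)])
      (use * m_abs_fract_minus_diff[OF assms(1)] in \<open>auto intro: zq_local_closed(4)\<close>)
qed

lemma zq_cauchy_frob:
  assumes "prime p" "zq_cauchy p X"
  shows "zq_cauchy p (\<lambda>n. q_frob_fract p (X n))"
proof (rule zq_cauchy_bound[OF assms(2,2)])
  fix m n
  show "q_frob_fract p (X n) \<in> zq_local p"
    using assms by (intro q_frob_local zq_cauchy_local) (auto simp: prime_gt_0_nat)
  show "m_abs_fract p (q_frob_fract p (X m) - q_frob_fract p (X n)) \<le>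
      max (m_abs_fract p (X m - X n)) (m_abs_fract p (X m - X n))"
    using m_abs_frob_le[OF assms(1), of "X m - X n"] assms
    by (simp add: q_frob_fract_hom prime_gt_0_nat zq_local_closed zq_cauchy_local)
qed

text \<open>The completion of \<open>\<int>[q]\<^sub>\<mm>\<close> is the ring of Cauchy sequences modulo null sequences. Since a type
  cannot depend on a term, the prime is the cardinality of a type parameter: \<open>p = CARD('p)\<close>.\<close>

typedef 'p zq_seq = "{X. zq_cauchy CARD('p::prime_card) X}"
  using zq_cauchy_const[OF prime_card zq_local_0_1(1)] prime_gt_1_nat[OF prime_card] by blast

setup_lifting type_definition_zq_seq

instantiation zq_seq :: (prime_card) comm_ring_1
begin

lift_definition zero_zq_seq :: "'a zq_seq" is "\<lambda>_. 0"
  by (rule zq_cauchy_const[OF prime_card zq_local_0_1(1)[OF prime_gt_1_nat[OF prime_card]]])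

lift_definition one_zq_seq :: "'a zq_seq" is "\<lambda>_. 1"
  by (rule zq_cauchy_const[OF prime_card zq_local_0_1(2)[OF prime_gt_1_nat[OF prime_card]]])

lift_definition plus_zq_seq :: "'a zq_seq \<Rightarrow> 'a zq_seq \<Rightarrow> 'a zq_seq" is "\<lambda>X Y n. X n + Y n"
  by (rule zq_cauchy_closed[OF prime_card])

lift_definition minus_zq_seq :: "'a zq_seq \<Rightarrow> 'a zq_seq \<Rightarrow> 'a zq_seq" is "\<lambda>X Y n. X n - Y n"
  by (rule zq_cauchy_closed[OF prime_card])

lift_definition times_zq_seq :: "'a zq_seq \<Rightarrow> 'a zq_seq \<Rightarrow> 'a zq_seq" is "\<lambda>X Y n. X n * Y n"
  by (rule zq_cauchy_closed[OF prime_card])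

lift_definition uminus_zq_seq :: "'a zq_seq \<Rightarrow> 'a zq_seq" is "\<lambda>X n. - X n"
  by (rule zq_cauchy_closed(4)[OF prime_card])

instance
  by standard (transfer; simp add: fun_eq_iff algebra_simps)+

end

lift_definition zq_null :: "'p::prime_card zq_seq \<Rightarrow> bool" is
  "\<lambda>X. (\<lambda>n. m_abs_fract CARD('p) (X n)) \<longlonglongrightarrow> 0" .

lift_definition zq_seq_abs :: "'p::prime_card zq_seq \<Rightarrow> real" is
  "\<lambda>X. lim (\<lambda>n. m_abs_fract CARD('p) (X n))" .

lift_definition zq_seq_frob :: "'p::prime_card zq_seq \<Rightarrow> 'p zq_seq" is
  "\<lambda>X n. q_frob_fract CARD('p) (X n)"
  by (rule zq_cauchy_frob[OF prime_card])

lift_definition zq_seq_const :: "int poly fract \<Rightarrow> 'p::prime_card zq_seq" is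
  "\<lambda>x _. if x \<in> zq_local CARD('p) then x else 0"
  using zq_cauchy_const[OF prime_card] zq_local_0_1(1)[OF prime_gt_1_nat[OF prime_card]] by auto

lemma zq_seq_abs_tendsto:
  "(\<lambda>n. m_abs_fract CARD('p) (Rep_zq_seq X n)) \<longlonglongrightarrow> zq_seq_abs (X :: 'p::prime_card zq_seq)"
proof transfer
  fix X assume X: "zq_cauchy CARD('p) X"
  let ?N = "m_abs_fract CARD('p)"
  have "convergent (\<lambda>n. ?N (X n))"
  proof (rule Cauchy_convergent, rule metric_CauchyI)
    fix e :: real assume "e > 0"
    then obtain M where M: "\<forall>m\<ge>M. \<forall>n\<ge>M. ?N (X m - X n) < e"
      using zq_cauchyD[OF X] by blast
    have "dist (?N (X m)) (?N (X n)) < e" if "m \<ge> M" "n \<ge> M" for m n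
      using le_less_trans[OF m_abs_fract_triangle_diff[OF prime_card, of "X m" "X n"]] M that
      by (auto simp: dist_real_def)
    then show "\<exists>M. \<forall>m\<ge>M. \<forall>n\<ge>M. dist (?N (X m)) (?N (X n)) < e" by blast
  qed
  then show "(\<lambda>n. ?N (X n)) \<longlonglongrightarrow> lim (\<lambda>n. ?N (X n))"
    by (simp add: convergent_LIMSEQ_iff)
qed

lemma zq_seq_abs_eqI:
  "(\<lambda>n. m_abs_fract CARD('p) (Rep_zq_seq X n)) \<longlonglongrightarrow> c \<Longrightarrow> zq_seq_abs (X :: 'p::prime_card zq_seq) = c"
  using zq_seq_abs_tendsto LIMSEQ_unique by blast

lemma zq_null_iff: "zq_null X \<longleftrightarrow> zq_seq_abs X = 0"
  using zq_seq_abs_tendsto[of X] by (auto simp: zq_null.rep_eq intro: zq_seq_abs_eqI)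

lemma zq_seq_abs_nonneg [simp]: "zq_seq_abs X \<ge> 0"
  by (rule LIMSEQ_le_const[OF zq_seq_abs_tendsto]) auto

lemma zq_seq_abs_ultrametric:
  "zq_seq_abs (X + Y) \<le> max (zq_seq_abs X) (zq_seq_abs (Y :: 'p::prime_card zq_seq))"
  by (rule LIMSEQ_le[OF zq_seq_abs_tendsto tendsto_max[OF zq_seq_abs_tendsto zq_seq_abs_tendsto]])
     (use m_abs_fract_ultrametric[OF prime_card] in \<open>auto simp: plus_zq_seq.rep_eq\<close>)

lemma zq_seq_abs_mult:
  "zq_seq_abs (X * Y) = zq_seq_abs X * zq_seq_abs (Y :: 'p::prime_card zq_seq)"
  by (rule zq_seq_abs_eqI)
     (simp add: times_zq_seq.rep_eq m_abs_fract_mult prime_card tendsto_mult zq_seq_abs_tendsto)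

lemma zq_seq_abs_minus: "zq_seq_abs (- X) = zq_seq_abs (X :: 'p::prime_card zq_seq)"
  by (rule zq_seq_abs_eqI)
     (simp add: uminus_zq_seq.rep_eq m_abs_fract_minus prime_card zq_seq_abs_tendsto)

lemma zq_seq_abs_diff_commute: "zq_seq_abs (X - Y) = zq_seq_abs (Y - X)"
  using zq_seq_abs_minus[of "X - Y"] by simp

lemma zq_seq_abs_frob_le: "zq_seq_abs (zq_seq_frob X) \<le> zq_seq_abs (X :: 'p::prime_card zq_seq)"
proof (rule LIMSEQ_le[OF zq_seq_abs_tendsto zq_seq_abs_tendsto], intro exI allI impI)
  fix n
  have "Rep_zq_seq X n \<in> zq_local CARD('p)"
    using Rep_zq_seq[of X] by (auto intro: zq_cauchy_local)
  then show "m_abs_fract CARD('p) (Rep_zq_seq (zq_seq_frob X) n) \<le> m_abs_fract CARD('p) (Rep_zq_seq X n)"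
    by (simp add: zq_seq_frob.rep_eq m_abs_frob_le prime_card)
qed

lemma zq_seq_frob_hom:
  "zq_seq_frob (X + Y) = zq_seq_frob X + zq_seq_frob (Y :: 'p::prime_card zq_seq)"
  "zq_seq_frob (X - Y) = zq_seq_frob X - zq_seq_frob Y"
  "zq_seq_frob (X * Y) = zq_seq_frob X * zq_seq_frob Y"
  by (transfer, simp add: q_frob_fract_hom[OF prime_gt_0_nat[OF prime_card]])+

lemma zq_null_0: "zq_null (0 :: 'p::prime_card zq_seq)"
  by transfer (simp add: prime_card)

lemma zq_null_add: "zq_null X \<Longrightarrow> zq_null Y \<Longrightarrow> zq_null (X + Y)"
  using zq_seq_abs_ultrametric[of X Y] zq_seq_abs_nonneg[of "X + Y"] by (auto simp: zq_null_iff)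

lemma zq_null_mult: "zq_null X \<Longrightarrow> zq_null (Y * X)"
  by (simp add: zq_null_iff zq_seq_abs_mult)

lemma zq_null_minus: "zq_null (- X) = zq_null X"
  by (simp add: zq_null_iff zq_seq_abs_minus)

lemma zq_null_diff: "zq_null X \<Longrightarrow> zq_null Y \<Longrightarrow> zq_null (X - Y)"
  using zq_null_add[of X "- Y"] by (simp add: zq_null_minus)

quotient_type (overloaded) 'p zqp = "'p::prime_card zq_seq" / "\<lambda>X Y. zq_null (X - Y)"
proof (rule equivpI)
  show "reflp (\<lambda>X Y :: 'p zq_seq. zq_null (X - Y))" by (simp add: reflp_def zq_null_0)
  show "symp (\<lambda>X Y :: 'p zq_seq. zq_null (X - Y))"
    by (rule sympI) (metis zq_null_minus minus_diff_eq)
  show "transp (\<lambda>X Y :: 'p zq_seq. zq_null (X - Y))"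
    by (rule transpI) (metis zq_null_add diff_add_cancel add_diff_eq)
qed

instantiation zqp :: (prime_card) comm_ring_1
begin

lift_definition zero_zqp :: "'a zqp" is "0" .
lift_definition one_zqp :: "'a zqp" is "1" .

lift_definition plus_zqp :: "'a zqp \<Rightarrow> 'a zqp \<Rightarrow> 'a zqp" is "(+)"
  by (metis zq_null_add add_diff_add)

lift_definition uminus_zqp :: "'a zqp \<Rightarrow> 'a zqp" is "uminus"
  by (metis zq_null_minus minus_diff_minus)

lift_definition minus_zqp :: "'a zqp \<Rightarrow> 'a zqp \<Rightarrow> 'a zqp" is "(-)"
  by (drule (1) zq_null_diff, simp add: algebra_simps)

lift_definition times_zqp :: "'a zqp \<Rightarrow> 'a zqp \<Rightarrow> 'a zqp" is "(*)"
proof -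
  fix X X' Y Y' :: "'a zq_seq"
  assume "zq_null (X - X')" "zq_null (Y - Y')"
  then have "zq_null (Y * (X - X') + X' * (Y - Y'))" by (intro zq_null_add zq_null_mult)
  then show "zq_null (X * Y - X' * Y')" by (simp add: algebra_simps)
qed

instance
proof
  fix a b c :: "'a zqp"
  show "a * b * c = a * (b * c)" by transfer (simp add: mult.assoc zq_null_0)
  show "a * b = b * a" by transfer (simp add: mult.commute zq_null_0)
  show "1 * a = a" by transfer (simp add: zq_null_0)
  show "a + b + c = a + (b + c)" by transfer (simp add: add.assoc zq_null_0)
  show "a + b = b + a" by transfer (simp add: add.commute zq_null_0)
  show "0 + a = a" by transfer (simp add: zq_null_0)
  show "- a + a = 0" by transfer (simp add: zq_null_0)
  show "a - b = a + - b" by transfer (simp add: zq_null_0)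
  show "(a + b) * c = a * c + b * c" by transfer (simp add: distrib_right zq_null_0)
  show "(0 :: 'a zqp) \<noteq> 1"
  proof transfer
    have "zq_seq_abs (1 :: 'a zq_seq) * zq_seq_abs (1 :: 'a zq_seq) = zq_seq_abs (1 :: 'a zq_seq)"
      by (simp flip: zq_seq_abs_mult)
    have "\<not> zq_null (1 :: 'a zq_seq)"
      by transfer (simp add: LIMSEQ_const_iff m_abs_fract_eq_0_iff prime_card)
    then show "\<not> zq_null (0 - 1 :: 'a zq_seq)" by (metis zq_null_minus diff_0)
  qed
qed

end

lift_definition zqp_abs :: "'p::prime_card zqp \<Rightarrow> real" is zq_seq_abs
proof -
  fix X Y :: "'p zq_seq" assume "zq_null (X - Y)"
  then show "zq_seq_abs X = zq_seq_abs Y"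
    using zq_seq_abs_ultrametric[of "X - Y" Y] zq_seq_abs_ultrametric[of "Y - X" X]
      zq_seq_abs_diff_commute[of X Y] zq_seq_abs_nonneg[of X] zq_seq_abs_nonneg[of Y]
    by (simp add: zq_null_iff max_def split: if_splits)
qed

lift_definition zqp_frob :: "'p::prime_card zqp \<Rightarrow> 'p zqp" is zq_seq_frob
proof -
  fix X Y :: "'p zq_seq" assume "zq_null (X - Y)"
  then show "zq_null (zq_seq_frob X - zq_seq_frob Y)"
    using zq_seq_abs_frob_le[of "X - Y"] zq_seq_abs_nonneg[of "zq_seq_frob (X - Y)"]
    by (simp add: zq_null_iff flip: zq_seq_frob_hom)
qed

text \<open>The canonical map from the localization; the value outside \<open>zq_local CARD('p)\<close> is irrelevant.
  That it is a dense isometric ring embedding into a complete space is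
  \<open>zqp_of_local_hom\<close>, \<open>zqp_abs_of_local\<close>, \<open>zqp_of_local_dense\<close> and the \<open>complete_space\<close> instance.\<close>

lift_definition zqp_of_local :: "int poly fract \<Rightarrow> 'p::prime_card zqp" is zq_seq_const .

instantiation zqp :: (prime_card) metric_space
begin

definition dist_zqp :: "'a zqp \<Rightarrow> 'a zqp \<Rightarrow> real" where
  "dist_zqp x y = zqp_abs (x - y)"

definition uniformity_zqp :: "('a zqp \<times> 'a zqp) filter" where
  "uniformity_zqp = (INF e\<in>{0<..}. principal {(x, y). dist x y < e})"

definition open_zqp :: "'a zqp set \<Rightarrow> bool" where
  "open_zqp U \<longleftrightarrow> (\<forall>x\<in>U. \<forall>\<^sub>F (x', y) in uniformity. x' = x \<longrightarrow> y \<in> U)"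

instance
proof
  fix x y z :: "'a zqp"
  show "dist x y = 0 \<longleftrightarrow> x = y"
    unfolding dist_zqp_def by transfer (simp add: zq_null_iff)
  have "zqp_abs (x - y) \<le> max (zqp_abs (x - z)) (zqp_abs (y - z))"
  proof transfer
    fix X Y Z :: "'a zq_seq"
    show "zq_seq_abs (X - Y) \<le> max (zq_seq_abs (X - Z)) (zq_seq_abs (Y - Z))"
      using zq_seq_abs_ultrametric[of "X - Z" "Z - Y"] zq_seq_abs_diff_commute[of Z Y] by simp
  qed
  moreover have "zqp_abs w \<ge> 0" for w :: "'a zqp" by transfer simp
  ultimately show "dist x y \<le> dist x z + dist y z"
    unfolding dist_zqp_def by (smt (verit))
qed (simp_all add: uniformity_zqp_def open_zqp_def)

end

lemma zqp_abs_of_local: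
  "x \<in> zq_local CARD('p) \<Longrightarrow> zqp_abs (zqp_of_local x :: 'p::prime_card zqp) = m_abs_fract CARD('p) x"
  by (transfer fixing: x) (auto intro!: zq_seq_abs_eqI simp: zq_seq_const.rep_eq)

lemma zqp_of_local_hom:
  assumes "x \<in> zq_local CARD('p)" "y \<in> zq_local CARD('p)"
  shows "zqp_of_local (x + y) = (zqp_of_local x + zqp_of_local y :: 'p::prime_card zqp)"
    "zqp_of_local (x - y) = (zqp_of_local x - zqp_of_local y :: 'p::prime_card zqp)"
    "zqp_of_local (x * y) = (zqp_of_local x * zqp_of_local y :: 'p::prime_card zqp)"
    "zqp_of_local 1 = (1 :: 'p::prime_card zqp)"
proof -
  have "zq_seq_const (x + y) = (zq_seq_const x + zq_seq_const y :: 'p zq_seq)"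
    "zq_seq_const (x - y) = (zq_seq_const x - zq_seq_const y :: 'p zq_seq)"
    "zq_seq_const (x * y) = (zq_seq_const x * zq_seq_const y :: 'p zq_seq)"
    "zq_seq_const 1 = (1 :: 'p zq_seq)"
    using assms zq_local_0_1(2)[OF prime_gt_1_nat[OF prime_card[where 'a='p]]]
    by (simp_all add: zq_local_closed[OF prime_card] zq_seq_const.rep_eq plus_zq_seq.rep_eq
        minus_zq_seq.rep_eq times_zq_seq.rep_eq one_zq_seq.rep_eq fun_eq_iff
        flip: Rep_zq_seq_inject)
  then show "zqp_of_local (x + y) = (zqp_of_local x + zqp_of_local y :: 'p::prime_card zqp)"
    "zqp_of_local (x - y) = (zqp_of_local x - zqp_of_local y :: 'p::prime_card zqp)"
    "zqp_of_local (x * y) = (zqp_of_local x * zqp_of_local y :: 'p::prime_card zqp)"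
    "zqp_of_local 1 = (1 :: 'p::prime_card zqp)"
    by (simp_all add: zqp_of_local.abs_eq plus_zqp.abs_eq minus_zqp.abs_eq times_zqp.abs_eq
        one_zqp.abs_eq)
qed

lemma dist_zqp_of_local:
  "x \<in> zq_local CARD('p) \<Longrightarrow> y \<in> zq_local CARD('p) \<Longrightarrow>
    dist (zqp_of_local x :: 'p::prime_card zqp) (zqp_of_local y) = m_abs_fract CARD('p) (x - y)"
  by (simp add: dist_zqp_def zqp_abs_of_local zq_local_closed[OF prime_card] flip: zqp_of_local_hom(2))

lemma zqp_of_local_dense:
  assumes "e > 0"
  shows "\<exists>r\<in>zq_local CARD('p). dist (y :: 'p::prime_card zqp) (zqp_of_local r) < e"
  unfolding dist_zqp_def
proof (transfer fixing: e)
  fix Y :: "'p zq_seq"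
  let ?N = "m_abs_fract CARD('p)"
  obtain M where M: "\<forall>m\<ge>M. \<forall>n\<ge>M. ?N (Rep_zq_seq Y m - Rep_zq_seq Y n) < e / 2"
    using zq_cauchyD[of "CARD('p)" "Rep_zq_seq Y" "e / 2"] Rep_zq_seq[of Y] assms by auto
  define r where "r = Rep_zq_seq Y M"
  have r: "r \<in> zq_local CARD('p)" using Rep_zq_seq[of Y] by (auto simp: r_def intro: zq_cauchy_local)
  have "zq_seq_abs (Y - zq_seq_const r) \<le> e / 2"
    by (rule LIMSEQ_le_const2[OF zq_seq_abs_tendsto])
       (use M r in \<open>auto simp: minus_zq_seq.rep_eq zq_seq_const.rep_eq r_def less_imp_le intro!: exI[of _ M]\<close>)
  then show "\<exists>r\<in>zq_local CARD('p). zq_seq_abs (Y - zq_seq_const r) < e"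
    using r assms by force
qed

instance zqp :: (prime_card) complete_space
proof
  fix x :: "nat \<Rightarrow> 'a zqp" assume x: "Cauchy x"
  let ?N = "m_abs_fract CARD('a)"
  have "\<exists>r\<in>zq_local CARD('a). dist (x k) (zqp_of_local r) < 1 / Suc k" for k
    by (rule zqp_of_local_dense) simp
  then obtain r where r: "\<And>k. r k \<in> zq_local CARD('a)"
    "\<And>k. dist (x k) (zqp_of_local (r k)) < 1 / Suc k" by metis
  have inv: "(\<lambda>k. 1 / real (Suc k)) \<longlonglongrightarrow> 0"
    using LIMSEQ_inverse_real_of_nat by (simp add: inverse_eq_divide)
  have dx: "(\<lambda>k. dist (x k) (zqp_of_local (r k))) \<longlonglongrightarrow> 0"
    by (rule tendsto_sandwich[OF _ _ tendsto_const inv];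
        intro always_eventually allI zero_le_dist less_imp_le[OF r(2)])
  have cauchy: "zq_cauchy CARD('a) r"
  proof (rule zq_cauchyI[OF r(1)])
    fix e :: real assume e: "e > 0"
    obtain M1 where M1: "\<forall>m\<ge>M1. \<forall>n\<ge>M1. dist (x m) (x n) < e / 3"
      using metric_CauchyD[OF x, of "e / 3"] e by auto
    obtain M2 where M2: "\<forall>n\<ge>M2. dist (x n) (zqp_of_local (r n)) < e / 3"
      using order_tendstoD(2)[OF dx, of "e / 3"] e by (auto simp: eventually_sequentially)
    have "?N (r m - r n) < e" if "m \<ge> max M1 M2" "n \<ge> max M1 M2" for m n
    proof -
      have "dist (x m) (x n) < e / 3" "dist (x m) (zqp_of_local (r m)) < e / 3"
        "dist (x n) (zqp_of_local (r n)) < e / 3" using M1 M2 that by auto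
      then have "dist (zqp_of_local (r m)) (zqp_of_local (r n) :: 'a zqp) < e"
        using dist_triangle[of "zqp_of_local (r m)" "zqp_of_local (r n)" "x n"]
          dist_triangle2[of "zqp_of_local (r m)" "x n" "x m"]
        by (simp add: dist_commute)
      then show ?thesis by (simp add: dist_zqp_of_local r)
    qed
    then show "\<exists>M. \<forall>m\<ge>M. \<forall>n\<ge>M. ?N (r m - r n) < e" by blast
  qed
  define R :: "'a zq_seq" where "R = Abs_zq_seq r"
  have R: "Rep_zq_seq R = r" unfolding R_def using cauchy by (simp add: Abs_zq_seq_inverse)
  have "(\<lambda>k. zq_seq_abs (zq_seq_const (r k) - R)) \<longlonglongrightarrow> 0"
  proof (rule LIMSEQ_I)
    fix e :: real assume "e > 0"
    then obtain M where M: "\<forall>m\<ge>M. \<forall>n\<ge>M. ?N (r m - r n) < e / 2"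
      using zq_cauchyD[OF cauchy, of "e / 2"] by auto
    have "zq_seq_abs (zq_seq_const (r k) - R) \<le> e / 2" if "k \<ge> M" for k
      by (rule LIMSEQ_le_const2[OF zq_seq_abs_tendsto])
         (use M r that in \<open>auto simp: minus_zq_seq.rep_eq zq_seq_const.rep_eq R less_imp_le intro!: exI[of _ M]\<close>)
    then show "\<exists>M. \<forall>k\<ge>M. norm (zq_seq_abs (zq_seq_const (r k) - R) - 0) < e"
      using \<open>e > 0\<close> by (intro exI[of _ M]) force
  qed
  moreover have "zq_seq_abs (zq_seq_const (r k) - R) = dist (zqp_of_local (r k)) (abs_zqp R)" for k
    by (simp add: dist_zqp_def zqp_of_local.abs_eq minus_zqp.abs_eq zqp_abs.abs_eq)
  ultimately have dR: "(\<lambda>k. dist (zqp_of_local (r k)) (abs_zqp R)) \<longlonglongrightarrow> 0" by simp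
  have "x \<longlonglongrightarrow> abs_zqp R"
  proof (rule tendsto_dist_iff[THEN iffD2], rule tendsto_sandwich[OF _ _ tendsto_const])
    show "(\<lambda>k. dist (x k) (zqp_of_local (r k)) + dist (zqp_of_local (r k)) (abs_zqp R)) \<longlonglongrightarrow> 0"
      using tendsto_add[OF dx dR] by simp
  qed (auto intro!: always_eventually dist_triangle)
  then show "convergent x" by (auto simp: convergent_def)
qed

text \<open>\<open>zqp_frob\<close> is the continuous ring endomorphism extending \<open>P(q)/Q(q) \<mapsto> P(q\<^sup>p)/Q(q\<^sup>p)\<close>.\<close>

lemma zqp_frob_of_local:
  assumes "Q \<notin> m_ideal CARD('p)"
  shows "zqp_frob (zqp_of_local (Fraction_Field.Fract P Q)) =
    (zqp_of_local (Fraction_Field.Fract (pcompose P ([:0, 1:] ^ CARD('p)))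
      (pcompose Q ([:0, 1:] ^ CARD('p)))) :: 'p::prime_card zqp)"
proof -
  let ?x = "Fraction_Field.Fract P Q"
  have p: "CARD('p) > 0" by simp
  have x: "?x \<in> zq_local CARD('p)" using assms by (rule zq_local_Fract)
  have "zq_seq_frob (zq_seq_const ?x) = (zq_seq_const (q_frob_fract CARD('p) ?x) :: 'p zq_seq)"
    using x q_frob_local[OF p x]
    by (simp add: zq_seq_const.rep_eq zq_seq_frob.rep_eq fun_eq_iff flip: Rep_zq_seq_inject)
  moreover have "Q \<noteq> 0" using assms by (auto simp: m_ideal_iff)
  ultimately show ?thesis
    by (simp add: zqp_of_local.abs_eq zqp_frob.abs_eq q_frob_Fract)
qed

lemma zqp_frob_hom:
  "zqp_frob (x + y) = zqp_frob x + zqp_frob (y :: 'p::prime_card zqp)"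
  "zqp_frob (x - y) = zqp_frob x - zqp_frob (y :: 'p::prime_card zqp)"
  "zqp_frob (x * y) = zqp_frob x * zqp_frob (y :: 'p::prime_card zqp)"
  "zqp_frob 1 = (1 :: 'p::prime_card zqp)"
proof -
  show "zqp_frob (x + y) = zqp_frob x + zqp_frob y" "zqp_frob (x - y) = zqp_frob x - zqp_frob y"
    "zqp_frob (x * y) = zqp_frob x * zqp_frob y"
    by (transfer; simp add: zq_seq_frob_hom zq_null_0)+
  have "zqp_of_local 1 = (1 :: 'p zqp)"
    using zq_local_0_1[OF prime_gt_1_nat[OF prime_card[where 'a='p]]] zqp_of_local_hom(4) by blast
  then show "zqp_frob 1 = (1 :: 'p zqp)"
    using zqp_frob_of_local[of 1 1, where 'p='p] prime_gt_Suc_0_nat[OF prime_card[where 'a='p]]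
    by (simp add: m_ideal_iff pcompose_1 flip: One_fract_def)
qed

lemma zqp_abs_frob_le: "zqp_abs (zqp_frob x) \<le> zqp_abs x"
  by transfer (rule zq_seq_abs_frob_le)

lemma continuous_on_zqp_frob: "continuous_on A zqp_frob"
  unfolding continuous_on_def
proof (intro ballI tendstoI)
  fix x :: "'a zqp" and e :: real
  assume "e > 0"
  then have "\<forall>\<^sub>F y in at x within A. dist y x < e"
    by (rule tendstoD[OF tendsto_ident_at])
  then show "\<forall>\<^sub>F y in at x within A. dist (zqp_frob y) (zqp_frob x) < e"
    by eventually_elim
       (use zqp_abs_frob_le le_less_trans in \<open>fastforce simp: dist_zqp_def simp flip: zqp_frob_hom(2)\<close>)
qed

definition zqp_q :: "'p::prime_card zqp" where
  "zqp_q = zqp_of_local (to_fract [:0, 1:])"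

definition padic_abs :: "nat \<Rightarrow> rat \<Rightarrow> real" where
  "padic_abs p x = (case quotient_of x of (r, s) \<Rightarrow>
     if x = 0 then 0 else real p powi (int (multiplicity (int p) s) - int (multiplicity (int p) r)))"

text \<open>The \<open>p\<close>-adic digits of a rational number whose denominator is prime to \<open>p\<close>, that is, of a rational
  element of \<open>\<int>\<^sub>p\<close>; the underlying \<open>THE\<close> is unspecified for other rationals.\<close>

definition padic_digits :: "nat \<Rightarrow> rat \<Rightarrow> nat \<Rightarrow> nat" where
  "padic_digits p \<beta> = (THE s. (\<forall>n. s n < p) \<and>
     (\<lambda>j. padic_abs p (\<beta> - of_nat (\<Sum>n\<le>j. s n * p ^ n))) \<longlonglongrightarrow> 0)"

definition padic_trunc :: "nat \<Rightarrow> rat \<Rightarrow> nat \<Rightarrow> nat" where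
  "padic_trunc p \<beta> j = (\<Sum>n\<le>j. padic_digits p \<beta> n * p ^ n)"

definition zqp_q_power :: "rat \<Rightarrow> 'p::prime_card zqp" where
  "zqp_q_power \<beta> = lim (\<lambda>j. zqp_q ^ padic_trunc CARD('p) \<beta> j)"

definition gauss_norm :: "'p::prime_card zqp fps \<Rightarrow> real" where
  "gauss_norm f = (SUP n. zqp_abs (fps_nth f n))"

text \<open>A polynomial \<open>Q\<close> with \<open>|Q(0)| = 1\<close> is a unit of \<open>\<int>\<^sub>q\<^sub>,\<^sub>p[[z]]\<close>, so the condition
  \<open>f * Q = P\<close> says that \<open>f\<close> is the fraction \<open>P / Q\<close>.\<close>

definition zqp_poly_local :: "'p::prime_card zqp fps set" where
  "zqp_poly_local = {f. \<exists>P Q. zqp_abs (poly Q 0) = 1 \<and> f * fps_of_poly Q = fps_of_poly P}"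

text \<open>\<open>\<int>\<^sub>q\<^sub>,\<^sub>p[[z]]\<close> is complete for the Gauss norm, so the completion of a subring is its closure.\<close>

definition E_ring :: "'p::prime_card zqp fps set" where
  "E_ring = {f. \<forall>e>0. \<exists>g\<in>zqp_poly_local. gauss_norm (f - g) < e}"

definition sigma_q :: "'p::prime_card zqp fps \<Rightarrow> 'p zqp fps" where
  "sigma_q f = Abs_fps (\<lambda>n. fps_nth f n * zqp_q ^ n)"

definition frob_q :: "'p::prime_card zqp fps \<Rightarrow> 'p zqp fps" where
  "frob_q f = Abs_fps (\<lambda>n. if CARD('p) dvd n then zqp_frob (fps_nth f (n div CARD('p))) else 0)"

text \<open>The list \<open>[a\<^sub>1, \<dots>, a\<^sub>n]\<close> encodes \<open>\<sigma>\<^sub>q\<^sup>n + a\<^sub>1 \<sigma>\<^sub>q\<^sup>n\<^sup>-\<^sup>1 + \<cdots> + a\<^sub>n\<close>. As \<open>1, q, q\<^sup>2, \<dots>\<close> are distinct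
  elements of an integral domain, the operator determines the list.\<close>

definition q_diff_op :: "'p::prime_card zqp fps list \<Rightarrow> 'p zqp fps \<Rightarrow> 'p zqp fps" where
  "q_diff_op as f = (sigma_q ^^ length as) f +
     (\<Sum>i=1..length as. as ! (i - 1) * (sigma_q ^^ (length as - i)) f)"

definition companion_mat :: "'p::prime_card zqp fps list \<Rightarrow> 'p zqp fps mat" where
  "companion_mat as = mat (length as) (length as) (\<lambda>(i, j).
     if i = length as - 1 then - as ! (length as - 1 - j) else if j = i + 1 then 1 else 0)"

definition GL_E :: "nat \<Rightarrow> 'p::prime_card zqp fps mat set" where
  "GL_E n = {H \<in> carrier_mat n n. elements_mat H \<subseteq> E_ring \<and>
     (\<exists>K \<in> carrier_mat n n. elements_mat K \<subseteq> E_ring \<and> inverts_mat H K \<and> inverts_mat K H)}"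

definition has_strong_frobenius_structure ::
    "('p::prime_card zqp fps \<Rightarrow> 'p zqp fps) \<Rightarrow> nat \<Rightarrow> bool" where
  "has_strong_frobenius_structure L h \<longleftrightarrow> h > 0 \<and>
     (\<exists>as. set as \<subseteq> E_ring \<and> L = q_diff_op as \<and>
       (\<exists>H \<in> GL_E (length as).
          map_mat sigma_q H * map_mat (frob_q ^^ h) (companion_mat as) = companion_mat as * H))"

text \<open>\<open>(1 - z) / (1 - q\<^sup>\<alpha> z)\<close>\<close>

definition hypergeom_coeff :: "rat \<Rightarrow> 'p::prime_card zqp fps" where
  "hypergeom_coeff \<alpha> = (1 - fps_X) * fps_right_inverse (1 - fps_const (zqp_q_power \<alpha>) * fps_X) 1"

lemma hypergeom_coeff_eq:
  "(1 - fps_const (zqp_q_power \<alpha>) * fps_X) * hypergeom_coeff \<alpha> = 1 - (fps_X :: 'p::prime_card zqp fps)"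
  unfolding hypergeom_coeff_def
  using fps_right_inverse[of "1 - fps_const (zqp_q_power \<alpha> :: 'p zqp) * fps_X" 1]
  by (simp add: mult.left_commute)

definition hypergeom_op :: "rat \<Rightarrow> 'p::prime_card zqp fps \<Rightarrow> 'p zqp fps" where
  "hypergeom_op \<alpha> f = sigma_q f - hypergeom_coeff \<alpha> * f"

lemma hypergeom_op_conv: "hypergeom_op \<alpha> = q_diff_op [- hypergeom_coeff \<alpha>]"
  by (simp add: fun_eq_iff hypergeom_op_def q_diff_op_def)

end

theory Submission
  imports Defs
begin

text \<open>Put \<open>\<mu> = (p - 1)\<alpha>\<close>, an integer with \<open>0 < \<mu> < p\<close>, so that \<open>p\<alpha> = \<alpha> + \<mu>\<close>. The formal solution
  \<open>f = (q\<^sup>\<alpha> z; q)\<^sub>\<infinity> / (z; q)\<^sub>\<infinity>\<close> of the equation suggests \<open>H = f / \<F>\<^sub>q(f)\<close>. Replacing \<open>\<alpha>\<close> by its \<open>p\<close>-adic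
  truncations \<open>M\<^sub>s\<close>, which satisfy \<open>p M\<^sub>s = M\<^sub>s\<^sub>+\<^sub>1 + \<mu>\<close>, turns \<open>H\<close> into the limit of \<open>T / W\<^sub>s\<close>, where
  \<open>T = \<Prod>\<^sub>j\<^sub><\<^sub>\<mu> (1 - q\<^sup>\<alpha> q\<^sup>j z)\<close>, \<open>W\<^sub>s = \<Prod>\<^sub>i g\<^sub>i\<close> over \<open>i < M\<^sub>s\<close>, and
  \<open>g\<^sub>i = (q\<^bsup>pi\<^esup> z; q)\<^sub>p / (1 - q\<^bsup>pi\<^esup> z\<^sup>p)\<close>. Modulo \<open>\<mm>\<close> the numerator of \<open>g\<^sub>i\<close> is
  \<open>(1 - z)\<^sup>p \<equiv> 1 - z\<^sup>p\<close>, so \<open>g\<^sub>i \<equiv> 1\<close>; moreover \<open>g\<^sub>i\<close> depends on \<open>i\<close> only through \<open>q\<^bsup>pi\<^esup>\<close>. Since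
  \<open>x \<equiv> 1\<close> mod \<open>\<mm>\<^sup>k\<close> gives \<open>x\<^sup>p \<equiv> 1\<close> mod \<open>\<mm>\<^bsup>k+1\<^esup>\<close>, a product of \<open>p\<^sup>s\<close> consecutive \<open>g\<^sub>i\<close> is \<open>1\<close> modulo
  \<open>\<mm>\<^bsup>s+1\<^esup>\<close>, and the \<open>W\<^sub>s\<close> converge in the Gauss norm.\<close>

section \<open>Absolute value and Frobenius on the completion\<close>

lemma prime_CARD_gt_1: "CARD('p::prime_card) > 1"
  by (rule prime_gt_1_nat[OF prime_card])

lemma zqp_abs_nonneg [simp]: "zqp_abs x \<ge> 0"
  by transfer simp

lemma zqp_abs_0 [simp]: "zqp_abs 0 = 0"
  by transfer (simp add: zq_null_0 flip: zq_null_iff)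

lemma zqp_abs_eq_0_iff [simp]: "zqp_abs x = 0 \<longleftrightarrow> x = 0"
  using dist_eq_0_iff[of x 0] by (simp add: dist_zqp_def)

lemma zqp_abs_mult: "zqp_abs (x * y) = zqp_abs x * zqp_abs y"
  by transfer (rule zq_seq_abs_mult)

lemma zqp_abs_ultrametric: "zqp_abs (x + y) \<le> max (zqp_abs x) (zqp_abs y)"
  by transfer (rule zq_seq_abs_ultrametric)

lemma zqp_abs_minus [simp]: "zqp_abs (- x) = zqp_abs x"
  by transfer (rule zq_seq_abs_minus)

lemma zqp_abs_1 [simp]: "zqp_abs 1 = 1"
  using zqp_abs_mult[of 1 1] by simp

text \<open>Representing Cauchy sequences take values in \<open>zq_local\<close>, where the bound
  holds, and it passes to the limit.\<close>

lemma zqp_abs_le_1: "zqp_abs (x :: 'p::prime_card zqp) \<le> 1"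
proof transfer
  fix X :: "'p zq_seq"
  show "zq_seq_abs X \<le> 1"
    by (rule LIMSEQ_le_const2[OF zq_seq_abs_tendsto])
       (use Rep_zq_seq[of X] in \<open>auto intro!: m_abs_fract_le_1[OF prime_card] zq_cauchy_local\<close>)
qed

lemma zqp_abs_sum_le:
  "(\<And>i. i \<in> A \<Longrightarrow> zqp_abs (f i) \<le> c) \<Longrightarrow> c \<ge> 0 \<Longrightarrow> zqp_abs (sum f A) \<le> c"
proof (induction A rule: infinite_finite_induct)
  case (insert x A)
  then show ?case
    by (auto intro!: order.trans[OF zqp_abs_ultrametric])
qed auto

lemma zqp_of_local_of_nat:
  "zqp_of_local (of_nat n) = (of_nat n :: 'p::prime_card zqp)"
proof (induction n)
  case 0
  show ?case
    using zqp_of_local_hom(2)[of 1 1, where 'p='p] zq_local_0_1(2)[OF prime_CARD_gt_1[where 'p='p]]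
    by simp
next
  case (Suc n)
  have "(of_nat n :: int poly fract) \<in> zq_local CARD('p)"
    using zq_local_of_poly[OF prime_CARD_gt_1[where 'p='p], of "of_nat n"]
    by (simp add: of_nat_fract to_fract_def)
  then show ?case
    using zqp_of_local_hom[of 1 "of_nat n", where 'p='p] Suc
      zq_local_0_1(2)[OF prime_CARD_gt_1[where 'p='p]]
    by simp
qed

lemma zqp_abs_of_m_ideal:
  assumes "P \<in> m_ideal CARD('p)"
  shows "zqp_abs (zqp_of_local (to_fract P) :: 'p::prime_card zqp) \<le> 1 / real CARD('p)"
proof -
  have "m_abs CARD('p) P \<le> (1 / real CARD('p)) ^ 1"
    using assms by (subst m_abs_le_iff[OF prime_CARD_gt_1]) (simp only: m_power_1)
  moreover have "m_abs_fract CARD('p) (to_fract P) = m_abs CARD('p) P"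
    unfolding to_fract_def using prime_CARD_gt_1[where 'p='p]
    by (intro m_abs_local_Fract prime_card) (simp add: m_ideal_iff)
  ultimately show ?thesis
    by (simp add: zqp_abs_of_local zq_local_of_poly[OF prime_CARD_gt_1])
qed

lemma zqp_abs_prime: "zqp_abs (of_nat CARD('p) :: 'p::prime_card zqp) \<le> 1 / real CARD('p)"
proof -
  have "to_fract (of_nat CARD('p)) = (of_nat CARD('p) :: int poly fract)"
    by (simp add: to_fract_def of_nat_fract)
  then show ?thesis
    using zqp_abs_of_m_ideal[OF m_ideal_generators(1), where 'p='p]
    by (simp add: zqp_of_local_of_nat)
qed

lemma zqp_abs_q_minus_1: "zqp_abs (zqp_q - 1 :: 'p::prime_card zqp) \<le> 1 / real CARD('p)"
proof -
  have "zqp_of_local (to_fract (1 - [:0, 1:])) = (1 - zqp_q :: 'p zqp)"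
    using zqp_of_local_hom(2,4)[of 1 "to_fract [:0, 1:]", where 'p='p]
      zq_local_0_1(2)[OF prime_CARD_gt_1[where 'p='p]]
      zq_local_of_poly[OF prime_CARD_gt_1[where 'p='p]]
    by (simp add: zqp_q_def)
  then have "zqp_abs (1 - zqp_q :: 'p zqp) \<le> 1 / real CARD('p)"
    using zqp_abs_of_m_ideal[OF m_ideal_generators(2), where 'p='p] by simp
  then show ?thesis using zqp_abs_minus[of "1 - zqp_q :: 'p zqp"] by simp
qed

lemma zqp_frob_q: "zqp_frob zqp_q = (zqp_q :: 'p::prime_card zqp) ^ CARD('p)"
proof -
  have *: "to_fract P \<in> zq_local CARD('p)" for P
    by (rule zq_local_of_poly[OF prime_CARD_gt_1])
  have "zqp_of_local (to_fract (P ^ n)) = (zqp_of_local (to_fract P) :: 'p zqp) ^ n" for P n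
  proof (induction n)
    case (Suc n)
    then show ?case using zqp_of_local_hom(3)[OF * *, of P "P ^ n"] by simp
  qed (use zqp_of_local_hom(4)[OF * *] in simp)
  moreover have "zqp_frob zqp_q = (zqp_of_local (to_fract ([:0, 1:] ^ CARD('p))) :: 'p zqp)"
    unfolding zqp_q_def to_fract_def using prime_CARD_gt_1[where 'p='p]
    by (subst zqp_frob_of_local) (auto simp: m_ideal_iff pcompose_pCons pcompose_1)
  ultimately show ?thesis by (simp add: zqp_q_def)
qed

lemma zqp_frob_power: "zqp_frob (x ^ n) = zqp_frob x ^ n"
  by (induction n) (simp_all add: zqp_frob_hom)

lemma zqp_frob_0 [simp]: "zqp_frob 0 = 0"
  using zqp_frob_hom(2)[of 0 0] by simp

text \<open>By the ultrametric inequality the bound on one step bounds all later differences at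
  once, with no loss from summation, and it survives in the limit.\<close>

lemma zqp_tendsto_bound:
  fixes X :: "nat \<Rightarrow> 'p::prime_card zqp"
  assumes "\<And>n. zqp_abs (X (Suc n) - X n) \<le> (1 / real CARD('p)) ^ n"
  shows "X \<longlonglongrightarrow> lim X" "zqp_abs (lim X - X n) \<le> (1 / real CARD('p)) ^ n"
proof -
  let ?e = "1 / real CARD('p)"
  have e: "0 \<le> ?e" "?e < 1" using prime_CARD_gt_1[where 'p='p] by auto
  have bound: "zqp_abs (X (n + k) - X n) \<le> ?e ^ n" for n k
  proof (induction k)
    case (Suc k)
    have "?e ^ (n + k) \<le> ?e ^ n" using e by (intro power_decreasing) auto
    then show ?case
      using zqp_abs_ultrametric[of "X (Suc (n + k)) - X (n + k)" "X (n + k) - X n"]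
        assms[of "n + k"] Suc by simp
  qed simp
  have bound': "dist (X m) (X n) \<le> ?e ^ n" if "m \<ge> n" for m n
    using bound[of n "m - n"] that by (simp add: dist_zqp_def)
  have "Cauchy X"
  proof (rule metric_CauchyI)
    fix r :: real assume "r > 0"
    then obtain N where N: "?e ^ N < r / 2"
      using real_arch_pow_inv[of "r / 2" ?e] e by auto
    have "dist (X m) (X n) < r" if "m \<ge> N" "n \<ge> N" for m n
      using dist_triangle2[of "X m" "X n" "X N"] bound'[OF that(1)] bound'[OF that(2)] N by linarith
    then show "\<exists>N. \<forall>m\<ge>N. \<forall>n\<ge>N. dist (X m) (X n) < r" by blast
  qed
  then show lim: "X \<longlonglongrightarrow> lim X"
    by (simp add: Cauchy_convergent convergent_LIMSEQ_iff[symmetric])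
  have "dist (lim X) (X n) \<le> ?e ^ n"
    by (rule LIMSEQ_le_const2[OF tendsto_dist[OF lim tendsto_const]]) (use bound' in auto)
  then show "zqp_abs (lim X - X n) \<le> ?e ^ n" by (simp add: dist_zqp_def)
qed

section \<open>Congruences of power series in the Gauss norm\<close>

text \<open>Congruence mod \<mm>^k: the Gauss norm of f - g is at most p^(-k). The coefficientwise
  form avoids suprema.\<close>

definition gauss_cong :: "nat \<Rightarrow> 'p::prime_card zqp fps \<Rightarrow> 'p zqp fps \<Rightarrow> bool" where
  "gauss_cong k f g \<longleftrightarrow> (\<forall>n. zqp_abs (fps_nth (f - g) n) \<le> (1 / real CARD('p)) ^ k)"

lemma gauss_cong_refl [simp]: "gauss_cong k f f"
  by (simp add: gauss_cong_def)

lemma gauss_cong_sym: "gauss_cong k f g \<Longrightarrow> gauss_cong k g f"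
  unfolding gauss_cong_def by (metis fps_neg_nth minus_diff_eq zqp_abs_minus)

lemma gauss_cong_add:
  assumes "gauss_cong k f g" "gauss_cong k f' g'"
  shows "gauss_cong k (f + f') (g + g')"
  unfolding gauss_cong_def
proof
  fix n
  have "fps_nth (f + f' - (g + g')) n = fps_nth (f - g) n + fps_nth (f' - g') n" by simp
  then show "zqp_abs (fps_nth (f + f' - (g + g')) n) \<le> (1 / real CARD('a)) ^ k"
    using assms by (auto simp: gauss_cong_def simp del: fps_sub_nth
        intro!: order.trans[OF zqp_abs_ultrametric])
qed

lemma gauss_cong_trans [trans]: "gauss_cong k f g \<Longrightarrow> gauss_cong k g h \<Longrightarrow> gauss_cong k f h"
  using gauss_cong_add[of k f g g h] by (simp add: gauss_cong_def algebra_simps)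

lemma gauss_cong_0_iff: "gauss_cong k f g \<longleftrightarrow> gauss_cong k (f - g) 0"
  by (simp add: gauss_cong_def)

lemma gauss_cong_minus: "gauss_cong k f g \<Longrightarrow> gauss_cong k (- f) (- g)"
  unfolding gauss_cong_def by (metis fps_neg_nth minus_diff_minus zqp_abs_minus)

lemma gauss_cong_diff:
  "gauss_cong k f g \<Longrightarrow> gauss_cong k f' g' \<Longrightarrow> gauss_cong k (f - f') (g - g')"
  using gauss_cong_add[of k f g "- f'" "- g'"] gauss_cong_minus[of k f' g'] by simp

lemma gauss_cong_0_0 [simp]: "gauss_cong 0 f g"
  by (simp add: gauss_cong_def zqp_abs_le_1)

lemma gauss_cong_mult_0:
  fixes f g :: "'p::prime_card zqp fps"
  assumes "gauss_cong k f 0" "gauss_cong l g 0"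
  shows "gauss_cong (k + l) (f * g) 0"
  unfolding gauss_cong_def
proof
  fix n
  have "zqp_abs (fps_nth f i * fps_nth g (n - i)) \<le> (1 / real CARD('p)) ^ (k + l)" for i
    using assms unfolding zqp_abs_mult power_add gauss_cong_def by (intro mult_mono) auto
  then show "zqp_abs (fps_nth (f * g - 0) n) \<le> (1 / real CARD('p)) ^ (k + l)"
    by (simp add: fps_mult_nth zqp_abs_sum_le)
qed

text \<open>f f' - g g' = (f - g) f' + (f' - g') g, and the cofactors cost no precision since all
  coefficients have absolute value at most 1.\<close>

lemma gauss_cong_mult:
  assumes "gauss_cong k f g" "gauss_cong k f' g'"
  shows "gauss_cong k (f * f') (g * g')"
proof -
  have "gauss_cong k ((f - g) * f') 0" "gauss_cong k ((f' - g') * g) 0"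
    using assms gauss_cong_mult_0[OF _ gauss_cong_0_0]
    by (metis add.right_neutral gauss_cong_0_iff)+
  from gauss_cong_add[OF this] show ?thesis
    by (subst gauss_cong_0_iff) (simp add: algebra_simps)
qed

lemma gauss_cong_prod:
  "(\<And>i. i \<in> A \<Longrightarrow> gauss_cong k (f i) (g i)) \<Longrightarrow> gauss_cong k (prod f A) (prod g A)"
  by (induction A rule: infinite_finite_induct) (auto intro: gauss_cong_mult)

lemma gauss_cong_power: "gauss_cong k f g \<Longrightarrow> gauss_cong k (f ^ n) (g ^ n)"
  by (induction n) (auto intro: gauss_cong_mult)

lemma gauss_cong_sum:
  "(\<And>i. i \<in> A \<Longrightarrow> gauss_cong k (f i) (g i)) \<Longrightarrow> gauss_cong k (sum f A) (sum g A)"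
  by (induction A rule: infinite_finite_induct) (auto intro: gauss_cong_add)

lemma gauss_cong_mono:
  assumes "gauss_cong k f (g :: 'p::prime_card zqp fps)" "l \<le> k"
  shows "gauss_cong l f g"
proof -
  have "(1 / real CARD('p)) ^ k \<le> (1 / real CARD('p)) ^ l"
    using assms(2) prime_CARD_gt_1[where 'p='p] by (intro power_decreasing) auto
  then show ?thesis using assms(1) unfolding gauss_cong_def by (meson order.trans)
qed

lemma gauss_cong_const:
  "gauss_cong k (fps_const x) (fps_const y) \<longleftrightarrow> zqp_abs (x - y) \<le> (1 / real CARD('p)) ^ k"
  for x y :: "'p::prime_card zqp"
  by (auto simp: gauss_cong_def all_conj_distrib split: if_splits)

text \<open>The Gauss norm separates points. This turns identities known only for approximants into
  exact ones.\<close>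

lemma gauss_cong_eqI:
  fixes f g :: "'p::prime_card zqp fps"
  assumes "\<And>k. gauss_cong k f g"
  shows "f = g"
proof (rule fps_ext)
  fix n
  have e: "\<bar>1 / real CARD('p)\<bar> < 1" using prime_CARD_gt_1[where 'p='p] by auto
  have "zqp_abs (fps_nth (f - g) n) \<le> 0"
    by (rule LIMSEQ_le_const[OF LIMSEQ_power_zero])
       (use assms e in \<open>auto simp: gauss_cong_def\<close>)
  then have "zqp_abs (fps_nth (f - g) n) = 0" by (intro antisym) auto
  then show "fps_nth f n = fps_nth g n" by simp
qed

text \<open>Limits are taken coefficientwise; the error bound of \<open>zqp_tendsto_bound\<close> is
  uniform in the coefficient index.\<close>

lemma gauss_cong_limit:
  fixes f :: "nat \<Rightarrow> 'p::prime_card zqp fps"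
  assumes "\<And>n. gauss_cong n (f (Suc n)) (f n)"
  obtains g where "\<And>n. gauss_cong n g (f n)"
proof
  fix n
  show "gauss_cong n (Abs_fps (\<lambda>i. lim (\<lambda>n. fps_nth (f n) i))) (f n)"
    using zqp_tendsto_bound(2)[of "\<lambda>n. fps_nth (f n) i" n for i] assms
    by (simp add: gauss_cong_def)
qed

lemma gauss_cong_prime: "gauss_cong 1 (of_nat CARD('p)) (0 :: 'p::prime_card zqp fps)"
  using gauss_cong_const[of 1 "of_nat CARD('p)" "0 :: 'p zqp"] zqp_abs_prime[where 'p='p]
  by (simp add: fps_of_nat)

text \<open>f^p - 1 = (f - 1)(1 + f + ... + f^(p-1)), and the second factor is congruent to p, hence
  to 0, mod \<mm>. This gains one power of \<mm>.\<close>

lemma gauss_cong_power_prime: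
  fixes f :: "'p::prime_card zqp fps"
  assumes "gauss_cong (Suc k) f 1"
  shows "gauss_cong (Suc (Suc k)) (f ^ CARD('p)) 1"
proof -
  have 1: "gauss_cong 1 f 1" using assms by (rule gauss_cong_mono) simp
  have "gauss_cong 1 (\<Sum>i<CARD('p). f ^ i) (\<Sum>i<CARD('p). 1)"
    using gauss_cong_power[OF 1] by (intro gauss_cong_sum) simp
  also have "gauss_cong 1 (\<Sum>i<CARD('p). 1) (0 :: 'p zqp fps)"
    using gauss_cong_prime[where 'p='p] by simp
  finally have "gauss_cong (Suc k + 1) ((f - 1) * (\<Sum>i<CARD('p). f ^ i)) 0"
    using assms by (intro gauss_cong_mult_0) (simp_all add: gauss_cong_0_iff[symmetric])
  then show ?thesis
    by (subst gauss_cong_0_iff) (simp add: power_diff_1_eq)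
qed

text \<open>The inner binomial coefficients are divisible by p, and p lies in \<mm>.\<close>

lemma gauss_cong_freshman:
  fixes f g :: "'p::prime_card zqp fps"
  shows "gauss_cong 1 ((f + g) ^ CARD('p)) (f ^ CARD('p) + g ^ CARD('p))"
proof -
  let ?p = "CARD('p)"
  have p: "prime ?p" by (rule prime_card)
  let ?t = "\<lambda>k. of_nat (?p choose k) * f ^ k * g ^ (?p - k)"
  have "gauss_cong 1 (?t k) 0" if "k \<in> {0<..<?p}" for k
  proof -
    have "?p dvd (?p choose k)" using that p by (intro dvd_choose_prime) auto
    then obtain c where "?p choose k = ?p * c" by (elim dvdE)
    then have "?t k = of_nat ?p * (of_nat c * f ^ k * g ^ (?p - k))"
      by (simp add: mult.assoc)
    then show ?thesis
      using gauss_cong_mult_0[OF gauss_cong_prime gauss_cong_0_0] by (metis add.right_neutral)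
  qed
  then have "gauss_cong 1 (\<Sum>k\<in>{0<..<?p}. ?t k) (\<Sum>k\<in>{0<..<?p}. 0)"
    by (rule gauss_cong_sum)
  note cong = gauss_cong_add[OF this gauss_cong_refl[of 1 "f ^ ?p + g ^ ?p"]]
  have "{..?p} = insert 0 (insert ?p {0<..<?p})" by auto
  then have "(f + g) ^ ?p = (\<Sum>k\<in>{0<..<?p}. ?t k) + (f ^ ?p + g ^ ?p)"
    by (subst binomial_ring) (simp add: algebra_simps)
  then show ?thesis using cong by simp
qed

text \<open>q is 1 mod \<mm>, and each further p-th power gains one power of \<mm>.\<close>

lemma gauss_cong_q_power:
  "gauss_cong (Suc s) (fps_const (zqp_q ^ (CARD('p) ^ s * k))) (1 :: 'p::prime_card zqp fps)"
proof -
  have "gauss_cong (Suc s) (fps_const zqp_q ^ (CARD('p) ^ s)) (1 :: 'p zqp fps)"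
  proof (induction s)
    case 0
    then show ?case
      using gauss_cong_const[of 1 zqp_q "1 :: 'p zqp"] zqp_abs_q_minus_1[where 'p='p] by simp
  next
    case (Suc s)
    then show ?case
      using gauss_cong_power_prime[of s "fps_const zqp_q ^ (CARD('p) ^ s)"]
      by (simp add: power_mult[symmetric] mult.commute)
  qed
  from gauss_cong_power[OF this, of k] show ?thesis
    by (simp add: power_mult[symmetric] fps_const_power)
qed

section \<open>Membership in the ring \<open>E_ring\<close>\<close>

lemma gauss_norm_less:
  fixes f g :: "'p::prime_card zqp fps"
  assumes "gauss_cong k f g" "(1 / real CARD('p)) ^ k < e"
  shows "gauss_norm (f - g) < e"
proof -
  have "gauss_norm (f - g) \<le> (1 / real CARD('p)) ^ k"
    unfolding gauss_norm_def using assms(1) by (intro cSUP_least) (auto simp: gauss_cong_def)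
  then show ?thesis using assms(2) by simp
qed

lemma E_ringI:
  fixes f :: "'p::prime_card zqp fps"
  assumes "\<And>k. g k \<in> zqp_poly_local" "\<And>k. gauss_cong k f (g k)"
  shows "f \<in> E_ring"
  unfolding E_ring_def
proof safe
  fix e :: real assume "e > 0"
  then obtain k where "(1 / real CARD('p)) ^ k < e"
    using real_arch_pow_inv[of e "1 / real CARD('p)"] prime_CARD_gt_1[where 'p='p] by auto
  then show "\<exists>g\<in>zqp_poly_local. gauss_norm (f - g) < e"
    using assms gauss_norm_less by blast
qed

lemma zqp_poly_localI:
  assumes "f * g = fps_of_poly P" "g = fps_of_poly Q" "fps_nth g 0 = 1"
  shows "f \<in> zqp_poly_local"
proof -
  have "zqp_abs (poly Q 0) = 1" using assms by (simp add: poly_0_coeff_0)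
  then show ?thesis using assms unfolding zqp_poly_local_def by blast
qed

lemma zqp_poly_local_subset_E_ring: "zqp_poly_local \<subseteq> E_ring"
  by (auto intro: E_ringI[of "\<lambda>_. f" f for f])

section \<open>p-adic digits of a rational number\<close>

text \<open>Let r/s be the reduced form of n/d. From r d = n s and p not dividing d, the
  multiplicities of p in r and s differ by that of n.\<close>

lemma padic_abs_le_iff:
  fixes n d :: int
  assumes "prime p" "\<not> int p dvd d"
  shows "padic_abs p (of_int n / of_int d) \<le> (1 / real p) ^ k \<longleftrightarrow> int p ^ k dvd n"
proof (cases "n = 0")
  case True
  then show ?thesis by (simp add: padic_abs_def)
next
  case False
  obtain r s where rs: "quotient_of (of_int n / of_int d) = (r, s)"
    by (cases "quotient_of (of_int n / of_int d)")
  have p: "p > 1" and pe: "prime_elem (int p)" using assms(1) prime_gt_1_nat by auto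
  have "d \<noteq> 0" using assms(2) by auto
  have "s > 0" using rs by (rule quotient_of_denom_pos)
  have eq: "(of_int n / of_int d :: rat) = of_int r / of_int s" using rs by (rule quotient_of_div)
  then have "(of_int (r * d) :: rat) = of_int (n * s)"
    using \<open>d \<noteq> 0\<close> \<open>s > 0\<close> by (simp add: field_simps)
  then have nat_eq: "r * d = n * s" by (simp only: of_int_eq_iff)
  with False \<open>s > 0\<close> have "r \<noteq> 0" by auto
  have "multiplicity (int p) r + multiplicity (int p) d =
      multiplicity (int p) n + multiplicity (int p) s"
    using arg_cong[OF nat_eq, of "multiplicity (int p)"] \<open>r \<noteq> 0\<close> \<open>d \<noteq> 0\<close> \<open>s > 0\<close> False pe
    by (simp add: prime_elem_multiplicity_mult_distrib)
  moreover have "multiplicity (int p) d = 0"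
    using assms(2) by (rule not_dvd_imp_multiplicity_0)
  ultimately have "padic_abs p (of_int n / of_int d) = real p powi (- int (multiplicity (int p) n))"
    using False \<open>d \<noteq> 0\<close> by (simp add: padic_abs_def rs)
  also have "\<dots> = (1 / real p) ^ multiplicity (int p) n"
    by (simp add: power_int_minus power_one_over inverse_eq_divide)
  finally have "padic_abs p (of_int n / of_int d) \<le> (1 / real p) ^ k \<longleftrightarrow> k \<le> multiplicity (int p) n"
    using p by (simp only: power_decreasing_iff) (subst power_decreasing_iff; simp)
  also have "\<dots> \<longleftrightarrow> int p ^ k dvd n"
    using False p by (subst power_dvd_iff_le_multiplicity) auto
  finally show ?thesis .
qed

lemma digit_sum_less:
  fixes s :: "nat \<Rightarrow> nat"
  assumes "\<And>n. s n < p"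
  shows "(\<Sum>n<k. s n * p ^ n) < p ^ k"
proof (induction k)
  case (Suc k)
  have "Suc (s k) * p ^ k \<le> p * p ^ k" using assms[of k] by (intro mult_right_mono) auto
  then show ?case using Suc by simp
qed simp

text \<open>The divisibility makes the truncations converge to \<beta>. For uniqueness, the partial
  sums of two digit sequences are congruent mod p^k and both lie below p^k, so they agree for every
  k.\<close>

lemma padic_digits_eqI:
  fixes m d :: int
  assumes p: "prime p" and d: "\<not> int p dvd d" and \<beta>: "\<beta> = of_int m / of_int d"
    and s: "\<And>n. s n < p" "\<And>k. int p ^ k dvd m - d * int (\<Sum>n<k. s n * p ^ n)"
  shows "padic_digits p \<beta> = s"
  unfolding padic_digits_def
proof (rule the_equality)
  have d0: "d \<noteq> 0" using d by auto
  have sub: "\<beta> - of_nat N = of_int (m - d * int N) / of_int d" for N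
    using d0 by (simp add: \<beta> field_simps)
  have e: "0 < 1 / real p" "1 / real p < 1" using prime_gt_1_nat[OF p] by auto
  \<comment> \<open>The sum up to j contains j + 1 digits, hence the exponent
    \<open>Suc j\<close>.\<close>
  have upper: "padic_abs p (\<beta> - of_nat (\<Sum>n\<le>j. s n * p ^ n)) \<le> (1 / real p) ^ Suc j" for j
    unfolding sub padic_abs_le_iff[OF p d] using s(2)[of "Suc j"] by (simp only: lessThan_Suc_atMost)
  have lower: "padic_abs p x \<ge> 0" for x
    by (simp add: padic_abs_def split: prod.split)
  have "(\<lambda>j. (1 / real p) ^ Suc j) \<longlonglongrightarrow> 0"
    by (rule LIMSEQ_Suc[OF LIMSEQ_realpow_zero]) (use e in auto)
  then have "(\<lambda>j. padic_abs p (\<beta> - of_nat (\<Sum>n\<le>j. s n * p ^ n))) \<longlonglongrightarrow> 0"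
    by (rule tendsto_sandwich[OF always_eventually always_eventually tendsto_const, rotated 2])
       (use upper lower in blast)+
  then show "(\<forall>n. s n < p) \<and> (\<lambda>j. padic_abs p (\<beta> - of_nat (\<Sum>n\<le>j. s n * p ^ n))) \<longlonglongrightarrow> 0"
    using s(1) by blast
  fix t assume t: "(\<forall>n. t n < p) \<and> (\<lambda>j. padic_abs p (\<beta> - of_nat (\<Sum>n\<le>j. t n * p ^ n))) \<longlonglongrightarrow> 0"
  have eq: "(\<Sum>n<k. t n * p ^ n) = (\<Sum>n<k. s n * p ^ n)" for k
  proof -
    let ?S = "\<Sum>n<k. s n * p ^ n" and ?T = "\<Sum>n<k. t n * p ^ n"
    have "\<forall>\<^sub>F j in sequentially. padic_abs p (\<beta> - of_nat (\<Sum>n\<le>j. t n * p ^ n)) < (1 / real p) ^ k"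
      using t e by (intro order_tendstoD(2)) auto
    \<comment> \<open>Truncate so late that the error is below p^(-k); the digits from position k on
      contribute a multiple of p^k and drop out.\<close>
    then obtain j where j: "j \<ge> k" "padic_abs p (\<beta> - of_nat (\<Sum>n\<le>j. t n * p ^ n)) < (1 / real p) ^ k"
      unfolding eventually_sequentially by (meson le_cases order_refl)
    have "int p ^ k dvd m - d * int (\<Sum>n\<le>j. t n * p ^ n)"
      using j(2) unfolding sub by (subst padic_abs_le_iff[OF p d, symmetric]) (rule less_imp_le)
    moreover have "{..j} = {..<k} \<union> {k..j}" using j(1) by auto
    then have "(\<Sum>n\<le>j. t n * p ^ n) = ?T + (\<Sum>n\<in>{k..j}. t n * p ^ n)"
      by (simp only:) (rule sum.union_disjoint, auto)
    moreover have "p ^ k dvd (\<Sum>n\<in>{k..j}. t n * p ^ n)"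
      by (intro dvd_sum dvd_mult le_imp_power_dvd) auto
    then obtain c where "(\<Sum>n\<in>{k..j}. t n * p ^ n) = p ^ k * c" by (elim dvdE)
    ultimately have "int p ^ k dvd m - d * int (?T + p ^ k * c)" by (simp only:)
    also have "m - d * int (?T + p ^ k * c) = m - d * int ?T - int p ^ k * (d * int c)"
      by (simp only: of_nat_add of_nat_mult of_nat_power) (simp only: algebra_simps)
    finally have "int p ^ k dvd (m - d * int ?T - int p ^ k * (d * int c)) + int p ^ k * (d * int c)"
      by (rule dvd_add) simp
    then have "int p ^ k dvd m - d * int ?T" by (simp only: diff_add_cancel)
    then have "int p ^ k dvd (m - d * int ?T) - (m - d * int ?S)"
      using s(2) by (rule dvd_diff)
    also have "(m - d * int ?T) - (m - d * int ?S) = (int ?S - int ?T) * d"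
      by (simp only: algebra_simps)
    finally have "int p ^ k dvd (int ?S - int ?T) * d" .
    moreover have "coprime (int p ^ k) d" using p d by (simp add: prime_imp_coprime)
    ultimately have "int p ^ k dvd int ?S - int ?T" by (simp only: coprime_dvd_mult_left_iff)
    moreover have "?S < p ^ k" "?T < p ^ k"
      using digit_sum_less s(1) t by blast+
    then have "int ?S < int p ^ k" "int ?T < int p ^ k" by (metis of_nat_less_iff of_nat_power)+
    then have "\<bar>int ?S - int ?T\<bar> < int p ^ k" by linarith
    ultimately have "int ?S - int ?T = 0"
      using dvd_imp_le_int[of "int ?S - int ?T" "int p ^ k"] by linarith
    then show ?thesis by linarith
  qed
  have "t n * p ^ n = s n * p ^ n" for n
    using eq[of n] eq[of "Suc n"] by simp
  then show "t = s" using prime_gt_0_nat[OF p] by (auto simp: fun_eq_iff)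
qed

text \<open>The truncations of \<open>\<mu> / (p - 1) = 1 + \<nu> / (1 - p)\<close>, where \<open>\<nu> = p - 1 - \<mu>\<close>.\<close>

definition geom_trunc :: "nat \<Rightarrow> nat \<Rightarrow> nat \<Rightarrow> nat" where
  "geom_trunc p \<nu> k = 1 + \<nu> * (\<Sum>n<k. p ^ n)"

lemma geom_trunc_Suc: "geom_trunc p \<nu> (Suc k) = geom_trunc p \<nu> k + p ^ k * \<nu>"
  by (simp add: geom_trunc_def algebra_simps)

text \<open>The truncated form of p\<alpha> = \<alpha> + \<mu>. Constant terms match because p -
  \<nu> = 1 + \<mu>.\<close>

lemma geom_trunc_mult:
  assumes "\<mu> + \<nu> + 1 = p"
  shows "p * geom_trunc p \<nu> k = geom_trunc p \<nu> (Suc k) + \<mu>"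
proof -
  have "(\<Sum>n<Suc k. p ^ n) = 1 + p * (\<Sum>n<k. p ^ n)"
    by (simp add: sum.lessThan_Suc_shift sum_distrib_left del: sum.lessThan_Suc)
  then show ?thesis using assms by (simp add: geom_trunc_def algebra_simps del: sum.lessThan_Suc)
qed

text \<open>The numerator of the truncation error of \<mu> / (p - 1); its factor p^k is what
  \<open>padic_digits_eqI\<close> asks for.\<close>

lemma geom_trunc_exact:
  assumes "\<mu> + \<nu> + 1 = p"
  shows "int \<mu> - (int p - 1) * int (geom_trunc p \<nu> k) = - int \<nu> * int p ^ k"
proof (induction k)
  case 0
  show ?case using assms by (simp add: geom_trunc_def)
next
  case (Suc k)
  then show ?case by (simp add: geom_trunc_Suc algebra_simps)
qed

lemma padic_trunc_geom:
  assumes p: "prime p" and sum: "\<mu> + \<nu> + 1 = p" and \<mu>: "\<mu> > 0"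
  shows "padic_trunc p (of_nat \<mu> / (of_nat p - 1)) j = geom_trunc p \<nu> (Suc j)"
proof -
  \<comment> \<open>Expanding \<nu> / (1 - p) geometrically gives the digits \<nu> + 1, \<nu>,
    \<nu>, ...; the first is p - \<mu>, a legal digit because \<mu> > 0.\<close>
  define s where "s = (\<lambda>n::nat. if n = 0 then Suc \<nu> else \<nu>)"
  have S: "(\<Sum>n<Suc k. s n * p ^ n) = geom_trunc p \<nu> (Suc k)" for k
    by (induction k) (simp_all add: s_def geom_trunc_def algebra_simps)
  have "padic_digits p (of_nat \<mu> / (of_nat p - 1)) = s"
  proof (rule padic_digits_eqI[OF p])
    show "\<not> int p dvd int p - 1"
      using prime_gt_1_nat[OF p] zdvd_not_zless[of "int p - 1" "int p"] by auto
    show "s n < p" for n using sum \<mu> by (auto simp: s_def)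
    \<comment> \<open>For k = 0 the empty digit sum is 0 while \<open>geom_trunc\<close> is 1, so
      this case is split off; there the divisor is 1.\<close>
    show "int p ^ k dvd int \<mu> - (int p - 1) * int (\<Sum>n<k. s n * p ^ n)" for k
      by (cases k) (simp_all only: S geom_trunc_exact[OF sum], simp_all)
  qed simp
  then show ?thesis by (simp only: padic_trunc_def S flip: lessThan_Suc_atMost)
qed

section \<open>The element \<open>q^\<alpha>\<close> and its image under Frobenius\<close>

lemma gauss_cong_q_power_add:
  "gauss_cong (Suc s) (fps_const (zqp_q ^ (n + CARD('p) ^ s * k)))
     (fps_const (zqp_q ^ n) :: 'p::prime_card zqp fps)"
  using gauss_cong_mult[OF gauss_cong_refl gauss_cong_q_power, of s "fps_const (zqp_q ^ n)" k]
  by (simp add: power_add)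

lemma gauss_cong_zqp_q_power:
  assumes sum: "\<mu> + \<nu> + 1 = CARD('p)" and \<mu>: "\<mu> > 0"
    and \<alpha>: "\<alpha> = of_nat \<mu> / (of_nat CARD('p) - 1)"
  shows "gauss_cong k (fps_const (zqp_q_power \<alpha>))
    (fps_const (zqp_q ^ geom_trunc CARD('p) \<nu> k) :: 'p::prime_card zqp fps)"
proof -
  let ?M = "geom_trunc CARD('p) \<nu>"
  have step: "zqp_abs (zqp_q ^ ?M (Suc n) - zqp_q ^ ?M n :: 'p zqp) \<le> (1 / real CARD('p)) ^ n" for n
    using gauss_cong_mono[OF gauss_cong_q_power_add[of n "?M n" \<nu>, where 'p='p], of n]
    by (simp add: geom_trunc_Suc gauss_cong_const)
  note lim = zqp_tendsto_bound[where X="\<lambda>n. zqp_q ^ ?M n :: 'p zqp", OF step]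
  \<comment> \<open>The truncation with top digit j is \<open>?M (Suc j)\<close>, so the defining
    sequence of \<open>zqp_q_power\<close> is a shift of this one.\<close>
  have "zqp_q_power \<alpha> = (lim (\<lambda>n. zqp_q ^ ?M n) :: 'p zqp)"
    unfolding zqp_q_power_def \<alpha> padic_trunc_geom[OF prime_card sum \<mu>]
    by (rule limI[OF LIMSEQ_Suc[OF lim(1)]])
  then show ?thesis using lim(2)[of k] by (simp add: gauss_cong_const)
qed

text \<open>Frobenius sends q^M to q^(pM) and does not increase absolute values, so it carries the
  approximation of q^\<alpha> along. The relation p M_k = M_(k+1) + \<mu> then yields the second
  claim in the limit.\<close>

lemma zqp_frob_q_power:
  assumes sum: "\<mu> + \<nu> + 1 = CARD('p)" and \<mu>: "\<mu> > 0"
    and \<alpha>: "\<alpha> = of_nat \<mu> / (of_nat CARD('p) - 1)"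
  shows "gauss_cong k (fps_const (zqp_frob (zqp_q_power \<alpha>)))
      (fps_const (zqp_q ^ (CARD('p) * geom_trunc CARD('p) \<nu> k)) :: 'p::prime_card zqp fps)"
    and "zqp_frob (zqp_q_power \<alpha>) = (zqp_q_power \<alpha> * zqp_q ^ \<mu> :: 'p zqp)"
proof -
  let ?M = "geom_trunc CARD('p) \<nu>" and ?A = "zqp_q_power \<alpha> :: 'p zqp"
  note A = gauss_cong_zqp_q_power[OF assms]
  show F: "gauss_cong k (fps_const (zqp_frob ?A)) (fps_const (zqp_q ^ (CARD('p) * ?M k)))" for k
  proof -
    have "zqp_frob ?A - zqp_q ^ (CARD('p) * ?M k) = zqp_frob (?A - zqp_q ^ ?M k)"
      by (simp add: zqp_frob_hom(2) zqp_frob_power zqp_frob_q flip: power_mult)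
    then show ?thesis
      using A[of k] zqp_abs_frob_le[of "?A - zqp_q ^ ?M k"] by (simp add: gauss_cong_const)
  qed
  have "gauss_cong k (fps_const (zqp_frob ?A)) (fps_const (?A * zqp_q ^ \<mu>))" for k
  proof -
    have "gauss_cong k (fps_const ?A * fps_const (zqp_q ^ \<mu>))
        (fps_const (zqp_q ^ ?M (Suc k)) * fps_const (zqp_q ^ \<mu>))"
      using gauss_cong_mono[OF A[of "Suc k"], of k] by (intro gauss_cong_mult) simp_all
    moreover have "zqp_q ^ ?M (Suc k) * zqp_q ^ \<mu> = (zqp_q ^ (CARD('p) * ?M k) :: 'p zqp)"
      by (simp add: geom_trunc_mult[OF sum] power_add)
    ultimately show ?thesis
      using gauss_cong_trans[OF F[of k] gauss_cong_sym] by simp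
  qed
  then have "fps_const (zqp_frob ?A) = fps_const (?A * zqp_q ^ \<mu>)" by (rule gauss_cong_eqI)
  then show "zqp_frob ?A = ?A * zqp_q ^ \<mu>" by (metis fps_nth_fps_const)
qed

section \<open>The quotients \<open>g_i\<close> and their products\<close>

lemma prod_lessThan_add:
  fixes f :: "nat \<Rightarrow> 'a::comm_monoid_mult"
  shows "(\<Prod>i<m + n. f i) = (\<Prod>i<m. f i) * (\<Prod>i<n. f (m + i))"
  by (induction n) (simp_all add: mult.assoc)

lemma prod_lessThan_mult:
  fixes f :: "nat \<Rightarrow> 'a::comm_monoid_mult"
  shows "(\<Prod>i<m * n. f i) = (\<Prod>i<n. \<Prod>j<m. f (m * i + j))"
proof (induction n)
  case (Suc n)
  have "m * Suc n = m * n + m" by simp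
  then show ?case by (simp only: prod_lessThan_add prod.lessThan_Suc Suc)
qed simp

text \<open>All series inverted here have constant coefficient 1; the second argument of
  \<open>fps_right_inverse\<close> is the inverse of that coefficient.\<close>

definition fps_inv1 :: "'a::comm_ring_1 fps \<Rightarrow> 'a fps" where
  "fps_inv1 f = fps_right_inverse f 1"

lemma fps_inv1:
  assumes "fps_nth f 0 = 1"
  shows "f * fps_inv1 f = 1" "fps_inv1 f * f = 1"
  using fps_right_inverse[of f 1] assms by (simp_all add: fps_inv1_def mult.commute)

lemma fps_inv1_nth_0 [simp]: "fps_nth (fps_inv1 f) 0 = 1"
  by (simp add: fps_inv1_def)

text \<open>Multiply the congruence of f and g by both inverses.\<close>

lemma gauss_cong_inv1:
  assumes "fps_nth f 0 = 1" "fps_nth g 0 = 1" "gauss_cong k f g"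
  shows "gauss_cong k (fps_inv1 f) (fps_inv1 g)"
proof -
  have "gauss_cong k (fps_inv1 f * (g * fps_inv1 g)) (fps_inv1 f * (f * fps_inv1 g))"
    by (intro gauss_cong_mult gauss_cong_refl gauss_cong_sym[OF assms(3)])
  then show ?thesis
    using fps_inv1(1)[OF assms(2)] fps_inv1(2)[OF assms(1)] by (simp flip: mult.assoc)
qed

text \<open>The q-Pochhammer symbol (a z; q)_n as a series in z.\<close>

definition q_poch :: "'p::prime_card zqp \<Rightarrow> nat \<Rightarrow> 'p zqp fps" where
  "q_poch a n = (\<Prod>i<n. 1 - fps_const (a * zqp_q ^ i) * fps_X)"

text \<open>The image of 1 - q^i z under Frobenius.\<close>

definition frob_denom :: "nat \<Rightarrow> 'p::prime_card zqp fps" where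
  "frob_denom i = 1 - fps_const (zqp_q ^ (CARD('p) * i)) * fps_X ^ CARD('p)"

text \<open>The factor \<open>g_i\<close>: p consecutive factors of (z; q)_\<infinity>, divided by
  the Frobenius image of its i-th factor.\<close>

definition frob_quot :: "nat \<Rightarrow> 'p::prime_card zqp fps" where
  "frob_quot i = q_poch (zqp_q ^ (CARD('p) * i)) CARD('p) * fps_inv1 (frob_denom i)"

lemma fps_nth_prod_0: "fps_nth (prod f A) 0 = (\<Prod>i\<in>A. fps_nth (f i) 0)"
  by (induction A rule: infinite_finite_induct) simp_all

lemma q_poch_nth_0 [simp]: "fps_nth (q_poch a n) 0 = 1"
  by (simp add: q_poch_def fps_nth_prod_0)

lemma frob_denom_nth_0 [simp]: "fps_nth (frob_denom i :: 'p::prime_card zqp fps) 0 = 1"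
  by (simp add: frob_denom_def fps_mult_nth_0)

lemma frob_quot_nth_0 [simp]: "fps_nth (frob_quot i) 0 = 1"
  by (simp add: frob_quot_def fps_mult_nth_0)

lemma frob_quot_mult:
  "frob_quot i * frob_denom i = q_poch (zqp_q ^ (CARD('p) * i) :: 'p::prime_card zqp) CARD('p)"
  by (simp add: frob_quot_def fps_inv1 mult.assoc)

lemma gauss_cong_q_poch:
  assumes "gauss_cong k (fps_const a) (fps_const b)"
  shows "gauss_cong k (q_poch a n) (q_poch b n)"
  unfolding q_poch_def fps_const_mult[symmetric]
  by (intro gauss_cong_prod gauss_cong_diff gauss_cong_mult gauss_cong_refl assms)

text \<open>The index enters only through q^(pi). Shifting i by p^s k shifts this exponent by
  p^(s+1) k, which explains the modulus \<mm>^(s+2).\<close>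

lemma frob_quot_shift:
  "gauss_cong (Suc (Suc s)) (frob_quot (i + CARD('p) ^ s * k)) (frob_quot i :: 'p::prime_card zqp fps)"
proof -
  have *: "gauss_cong (Suc (Suc s)) (fps_const (zqp_q ^ (CARD('p) * (i + CARD('p) ^ s * k))))
      (fps_const (zqp_q ^ (CARD('p) * i)) :: 'p zqp fps)"
    using gauss_cong_q_power_add[of "Suc s" "CARD('p) * i" k, where 'p='p]
    by (simp add: algebra_simps)
  have "gauss_cong (Suc (Suc s)) (frob_denom (i + CARD('p) ^ s * k)) (frob_denom i :: 'p zqp fps)"
    unfolding frob_denom_def by (intro gauss_cong_diff gauss_cong_mult gauss_cong_refl *)
  then show ?thesis
    unfolding frob_quot_def by (intro gauss_cong_mult gauss_cong_q_poch gauss_cong_inv1 *) simp_all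
qed

lemma frob_quot_cong_1: "gauss_cong 1 (frob_quot i) (1 :: 'p::prime_card zqp fps)"
proof -
  have q: "gauss_cong 1 (fps_const (zqp_q ^ n)) (1 :: 'p zqp fps)" for n
    using gauss_cong_q_power[of 0 n, where 'p='p] by simp
  have "gauss_cong 1 (q_poch (zqp_q ^ (CARD('p) * i)) CARD('p)) (\<Prod>j<CARD('p). 1 - 1 * fps_X :: 'p zqp fps)"
    unfolding q_poch_def power_add[symmetric]
    by (intro gauss_cong_prod gauss_cong_diff gauss_cong_mult gauss_cong_refl q)
  also have "(\<Prod>j<CARD('p). 1 - 1 * fps_X :: 'p zqp fps) = (1 - fps_X) ^ CARD('p)" by simp
  \<comment> \<open>Applied to (1 - z) + z = 1, the binomial congruence avoids the sign of (-z)^p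
    and a separate case p = 2.\<close>
  also have "gauss_cong 1 \<dots> (1 - fps_X ^ CARD('p))"
    using gauss_cong_diff[OF gauss_cong_sym[OF gauss_cong_freshman[of "1 - fps_X" fps_X]]
        gauss_cong_refl[of 1 "fps_X ^ CARD('p) :: 'p zqp fps"]]
    by simp
  also have "(1 - fps_X ^ CARD('p) :: 'p zqp fps) = 1 - 1 * fps_X ^ CARD('p)" by simp
  also have "gauss_cong 1 \<dots> (1 - fps_const (zqp_q ^ (CARD('p) * i)) * fps_X ^ CARD('p))"
    by (intro gauss_cong_diff gauss_cong_mult gauss_cong_refl gauss_cong_sym[OF q])
  finally have "gauss_cong 1 (frob_quot i) (frob_denom i * fps_inv1 (frob_denom i :: 'p zqp fps))"
    unfolding frob_quot_def frob_denom_def[symmetric] by (intro gauss_cong_mult gauss_cong_refl)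
  then show ?thesis by (simp add: fps_inv1)
qed

text \<open>Split p^(s+1) consecutive factors into p blocks of length p^s. The blocks agree mod
  \<mm>^(s+2) by \<open>frob_quot_shift\<close> and are 1 mod \<mm>^(s+1), so their product is a
  p-th power that gains one power of \<mm>.\<close>

lemma frob_quot_prod_cong:
  "gauss_cong (Suc s) (\<Prod>l<CARD('p) ^ s. frob_quot (i + l)) (1 :: 'p::prime_card zqp fps)"
proof (induction s)
  case 0
  then show ?case using frob_quot_cong_1[of i, where 'p='p] by simp
next
  case (Suc s)
  let ?P = "\<Prod>l<CARD('p) ^ s. frob_quot (i + l) :: 'p zqp fps"
  have "(\<Prod>l<CARD('p) ^ Suc s. frob_quot (i + l) :: 'p zqp fps) =
      (\<Prod>k<CARD('p). \<Prod>l<CARD('p) ^ s. frob_quot (i + l + CARD('p) ^ s * k))"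
    using prod_lessThan_mult[of "\<lambda>l. frob_quot (i + l)" "CARD('p) ^ s" "CARD('p)"]
    by (simp add: mult.commute add.assoc add.commute add.left_commute)
  also have "gauss_cong (Suc (Suc s)) \<dots> (\<Prod>k<CARD('p). ?P)"
    by (intro gauss_cong_prod frob_quot_shift)
  also have "(\<Prod>k<CARD('p). ?P) = ?P ^ CARD('p)" by simp
  also have "gauss_cong (Suc (Suc s)) \<dots> 1"
    using Suc by (rule gauss_cong_power_prime)
  finally show ?case .
qed

text \<open>The new factors form \<nu> blocks of p^s consecutive ones. This makes the products
  \<open>W_s\<close> a Cauchy sequence.\<close>

lemma frob_quot_trunc_cong:
  "gauss_cong (Suc s) (\<Prod>i<geom_trunc CARD('p) \<nu> (Suc s). frob_quot i)
     (\<Prod>i<geom_trunc CARD('p) \<nu> s. frob_quot i :: 'p::prime_card zqp fps)"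
proof -
  let ?M = "geom_trunc CARD('p) \<nu>"
  have "gauss_cong (Suc s)
      (\<Prod>k<\<nu>. \<Prod>l<CARD('p) ^ s. frob_quot (?M s + CARD('p) ^ s * k + l) :: 'p zqp fps) (\<Prod>k<\<nu>. 1)"
    by (intro gauss_cong_prod frob_quot_prod_cong)
  from gauss_cong_mult[OF gauss_cong_refl[of _ "\<Prod>i<?M s. frob_quot i"] this] show ?thesis
    by (simp add: geom_trunc_Suc prod_lessThan_add prod_lessThan_mult add.assoc)
qed

section \<open>q-difference equations of the finite products\<close>

lemma sigma_q_simps [simp]:
  fixes f g :: "'p::prime_card zqp fps"
  shows "sigma_q 1 = (1 :: 'p zqp fps)" "sigma_q (f - g) = sigma_q f - sigma_q g"
  "sigma_q (f * g) = sigma_q f * sigma_q g"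
  "sigma_q (fps_const c) = (fps_const c :: 'p zqp fps)"
  "sigma_q fps_X = fps_const (zqp_q :: 'p zqp) * fps_X"
proof -
  show "sigma_q (f * g) = sigma_q f * sigma_q g"
  proof (rule fps_ext)
    fix n
    have "(\<Sum>i=0..n. fps_nth f i * fps_nth g (n - i) * zqp_q ^ n) =
        (\<Sum>i=0..n. fps_nth f i * zqp_q ^ i * (fps_nth g (n - i) * zqp_q ^ (n - i)))"
    proof (rule sum.cong)
      fix i assume "i \<in> {0..n}"
      then have "(zqp_q :: 'p zqp) ^ n = zqp_q ^ i * zqp_q ^ (n - i)"
        by (simp flip: power_add)
      then show "fps_nth f i * fps_nth g (n - i) * zqp_q ^ n =
          fps_nth f i * zqp_q ^ i * (fps_nth g (n - i) * zqp_q ^ (n - i))"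
        by (subst \<open>zqp_q ^ n = _\<close>) (simp only: mult_ac)
    qed simp
    then show "fps_nth (sigma_q (f * g)) n = fps_nth (sigma_q f * sigma_q g) n"
      by (simp add: sigma_q_def fps_mult_nth sum_distrib_right)
  qed
qed (auto simp: sigma_q_def fps_eq_iff algebra_simps)

lemma sigma_q_power [simp]: "sigma_q (f ^ n) = sigma_q f ^ n"
  by (induction n) simp_all

lemma sigma_q_prod [simp]: "sigma_q (prod f A) = (\<Prod>i\<in>A. sigma_q (f i))"
  by (induction A rule: infinite_finite_induct) simp_all

lemma gauss_cong_sigma_q:
  assumes "gauss_cong k f g"
  shows "gauss_cong k (sigma_q f) (sigma_q g)"
  unfolding gauss_cong_def
proof
  fix n
  have "fps_nth (sigma_q f - sigma_q g) n = fps_nth (f - g) n * zqp_q ^ n"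
    by (simp add: sigma_q_def algebra_simps)
  then have "zqp_abs (fps_nth (sigma_q f - sigma_q g) n) \<le> zqp_abs (fps_nth (f - g) n)"
    by (simp add: zqp_abs_mult mult_left_le zqp_abs_le_1)
  then show "zqp_abs (fps_nth (sigma_q f - sigma_q g) n) \<le> (1 / real CARD('a)) ^ k"
    using assms unfolding gauss_cong_def by (meson order.trans)
qed

text \<open>\<open>sigma_q\<close> moves each factor to the next one; both sides equal (a z;
  q)_(n+1).\<close>

lemma sigma_q_poch:
  "sigma_q (q_poch a n) * (1 - fps_const a * fps_X) = q_poch a n * (1 - fps_const (a * zqp_q ^ n) * fps_X)"
proof -
  let ?f = "\<lambda>i. 1 - fps_const (a * zqp_q ^ i) * fps_X"
  have "sigma_q (?f i) = ?f (Suc i)" for i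
    by (simp add: fps_const_mult[symmetric] mult_ac del: fps_const_mult)
  then have "sigma_q (q_poch a n) * ?f 0 = (\<Prod>i<Suc n. ?f i)"
    by (simp add: q_poch_def prod.lessThan_Suc_shift mult.commute del: sigma_q_simps prod.lessThan_Suc)
  then show ?thesis by (simp add: q_poch_def)
qed

text \<open>The same telescoping in z^p, where \<open>sigma_q\<close> acts by the factor
  q^p.\<close>

lemma sigma_frob_denom_prod:
  "sigma_q (\<Prod>i<n. frob_denom i) * (1 - fps_X ^ CARD('p)) =
     (\<Prod>i<n. frob_denom i) * (frob_denom n :: 'p::prime_card zqp fps)"
proof -
  have *: "sigma_q (frob_denom i) = (frob_denom (Suc i) :: 'p zqp fps)" for i
    by (simp add: frob_denom_def power_mult_distrib power_add mult_ac fps_const_power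
        flip: fps_const_mult)
  have "sigma_q (\<Prod>i<n. frob_denom i) * frob_denom 0 = (\<Prod>i<Suc n. frob_denom i :: 'p zqp fps)"
    by (simp only: sigma_q_prod * prod.lessThan_Suc_shift mult.commute)
  then show ?thesis by (simp add: frob_denom_def)
qed

lemma frob_quot_prod_mult:
  "(\<Prod>i<n. frob_quot i) * (\<Prod>i<n. frob_denom i) = (q_poch 1 (CARD('p) * n) :: 'p::prime_card zqp fps)"
proof -
  have "(\<Prod>i<n. frob_quot i) * (\<Prod>i<n. frob_denom i) =
      (\<Prod>i<n. q_poch (zqp_q ^ (CARD('p) * i)) CARD('p) :: 'p zqp fps)"
    by (simp add: frob_quot_mult flip: prod.distrib)
  also have "\<dots> = q_poch 1 (CARD('p) * n)"
    by (simp add: q_poch_def prod_lessThan_mult power_add)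
  finally show ?thesis .
qed

text \<open>Divide the equation of W D = (z; q)_(pn) by that of the denominator product D. The
  identity is first proved times D, which is then cancelled as a unit.\<close>

lemma sigma_frob_quot_prod:
  fixes W :: "'p::prime_card zqp fps" and n :: nat
  defines "W \<equiv> \<Prod>i<n. frob_quot i" and "c \<equiv> fps_const (zqp_q ^ (CARD('p) * n) :: 'p zqp)"
  shows "sigma_q W * ((1 - fps_X) * (1 - c * fps_X ^ CARD('p))) =
    W * ((1 - c * fps_X) * (1 - fps_X ^ CARD('p)))"
proof -
  let ?D = "\<Prod>i<n. frob_denom i :: 'p zqp fps"
  have D0: "fps_nth ?D 0 = 1" by (simp add: fps_nth_prod_0)
  have WD: "W * ?D = q_poch 1 (CARD('p) * n)" unfolding W_def by (rule frob_quot_prod_mult)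
  have \<sigma>D: "sigma_q ?D * (1 - fps_X ^ CARD('p)) = ?D * (1 - c * fps_X ^ CARD('p))"
    unfolding sigma_frob_denom_prod by (simp add: frob_denom_def c_def)
  have \<sigma>WD: "sigma_q W * sigma_q ?D * (1 - fps_X) = W * ?D * (1 - c * fps_X)"
    using sigma_q_poch[of "1 :: 'p zqp" "CARD('p) * n"]
    unfolding fps_const_1_eq_1 mult_1_left WD sigma_q_simps(3)[symmetric] c_def .
  have "sigma_q W * ((1 - fps_X) * (1 - c * fps_X ^ CARD('p))) * ?D =
      sigma_q W * (1 - fps_X) * (?D * (1 - c * fps_X ^ CARD('p)))"
    by (simp only: mult_ac)
  also have "\<dots> = sigma_q W * sigma_q ?D * (1 - fps_X) * (1 - fps_X ^ CARD('p))"
    by (simp only: \<sigma>D[symmetric] mult_ac)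
  also have "\<dots> = W * ?D * (1 - c * fps_X) * (1 - fps_X ^ CARD('p))"
    by (simp only: \<sigma>WD)
  also have "\<dots> = W * ((1 - c * fps_X) * (1 - fps_X ^ CARD('p))) * ?D"
    by (simp only: mult_ac)
  finally have "sigma_q W * ((1 - fps_X) * (1 - c * fps_X ^ CARD('p))) * (?D * fps_inv1 ?D) =
      W * ((1 - c * fps_X) * (1 - fps_X ^ CARD('p))) * (?D * fps_inv1 ?D)"
    by (simp only: mult.assoc[symmetric])
  then show ?thesis by (simp only: fps_inv1(1)[OF D0] mult_1_right)
qed

section \<open>Frobenius on power series, and polynomial representatives\<close>

text \<open>Multiplicativity of Frobenius for a linear factor, compared coefficient by coefficient.
  It transports the equation (1 - q^\<alpha> z) c = 1 - z.\<close>

lemma frob_q_shifted_mult: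
  fixes f :: "'p::prime_card zqp fps"
  shows "frob_q ((1 - fps_const a * fps_X) * f) =
    (1 - fps_const (zqp_frob a) * fps_X ^ CARD('p)) * frob_q f"
proof (rule fps_ext)
  fix n
  have p: "CARD('p) > 0" by simp
  have lhs: "fps_nth ((1 - fps_const a * fps_X) * f) m =
      fps_nth f m - a * (if m = 0 then 0 else fps_nth f (m - 1))" for m
    by (simp add: algebra_simps)
  have rhs: "fps_nth ((1 - fps_const b * fps_X ^ k) * g) m =
      fps_nth g m - b * (if m < k then 0 else fps_nth g (m - k))" for b k m and g :: "'p zqp fps"
    by (simp add: left_diff_distrib mult.assoc fps_X_power_mult_nth)
  show "fps_nth (frob_q ((1 - fps_const a * fps_X) * f)) n =
      fps_nth ((1 - fps_const (zqp_frob a) * fps_X ^ CARD('p)) * frob_q f) n"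
  proof (cases "CARD('p) dvd n")
    case True
    then obtain m where m: "n = CARD('p) * m" by (elim dvdE)
    have "CARD('p) * m - CARD('p) = CARD('p) * (m - 1)" by (simp add: algebra_simps)
    then show ?thesis using p unfolding rhs
      by (cases m) (simp_all add: frob_q_def lhs m zqp_frob_hom)
  next
    case False
    then have "\<not> CARD('p) dvd n - CARD('p)" if "\<not> n < CARD('p)"
      using that by (simp add: dvd_minus_self)
    then show ?thesis using False unfolding rhs by (simp add: frob_q_def)
  qed
qed

lemma frob_q_1 [simp]: "frob_q 1 = (1 :: 'p::prime_card zqp fps)"
  by (auto simp: frob_q_def fps_eq_iff zqp_frob_hom(4) elim!: dvdE)

lemma q_poch_poly: "\<exists>P. q_poch a n = fps_of_poly P"
proof
  show "q_poch a n = fps_of_poly (\<Prod>i<n. 1 - [:a * zqp_q ^ i:] * [:0, 1:])"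
    by (simp add: q_poch_def fps_of_poly_prod fps_of_poly_diff fps_of_poly_pCons mult.commute)
qed

lemma frob_denom_prod_poly: "\<exists>P. (\<Prod>i<n. frob_denom i :: 'p::prime_card zqp fps) = fps_of_poly P"
proof
  show "(\<Prod>i<n. frob_denom i :: 'p zqp fps) =
      fps_of_poly (\<Prod>i<n. 1 - [:zqp_q ^ (CARD('p) * i):] * [:0, 1:] ^ CARD('p))"
    by (simp add: frob_denom_def fps_of_poly_prod fps_of_poly_mult fps_of_poly_diff fps_of_poly_power
        fps_of_poly_const fps_of_poly_fps_X del: mult_pCons_left)
qed

section \<open>The strong Frobenius structure\<close>

text \<open>In order 1 the companion matrix of [- c] has the single entry c, and an invertible H is
  a unit h with inverse k.\<close>

lemma strong_frobenius_order_1: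
  fixes c h k :: "'p::prime_card zqp fps"
  assumes "- c \<in> E_ring" "h \<in> E_ring" "k \<in> E_ring" "h * k = 1" "sigma_q h * frob_q c = c * h"
  shows "has_strong_frobenius_structure (q_diff_op [- c]) 1"
proof -
  define H where "H = mat 1 1 (\<lambda>_. h)"
  define K where "K = mat 1 1 (\<lambda>_. k)"
  have "H \<in> GL_E 1"
    unfolding GL_E_def mem_Collect_eq
  proof (intro conjI bexI[of _ K])
    show "inverts_mat H K" "inverts_mat K H"
      using assms(4) unfolding inverts_mat_def H_def K_def
      by (intro eq_matI; simp add: scalar_prod_def mult.commute)+
  qed (use assms(2,3) in \<open>auto simp: H_def K_def elements_mat_def\<close>)
  moreover have "map_mat sigma_q H * map_mat (frob_q ^^ 1) (companion_mat [- c]) = companion_mat [- c] * H"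
    using assms(5) unfolding H_def companion_mat_def
    by (intro eq_matI) (simp_all add: scalar_prod_def)
  ultimately show ?thesis
    unfolding has_strong_frobenius_structure_def using assms(1)
    by (intro conjI exI[of _ "[- c]"] bexI[of _ H]) simp_all
qed

text \<open>Take H = T / V with V the limit of the \<open>W s\<close>. With Q = q^(\<alpha>+\<mu>),
  \<open>sigma_q\<close> multiplies T by (1 - Qz) / (1 - Az) and V by (1 - Qz)(1 - z^p) / ((1 - z)(1
  - Qz^p)). The ratio of these two factors is c divided by its Frobenius image.\<close>

lemma hypergeom_strong_frobenius:
  assumes sum: "\<mu> + \<nu> + 1 = CARD('p)" and \<mu>: "\<mu> > 0"
    and \<alpha>: "\<alpha> = of_nat \<mu> / (of_nat CARD('p) - 1)"
  shows "has_strong_frobenius_structure (hypergeom_op \<alpha> :: 'p::prime_card zqp fps \<Rightarrow> _) 1"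
proof -
  define A where "A = (zqp_q_power \<alpha> :: 'p zqp)"
  define Q where "Q = zqp_frob A"
  define c where "c = (hypergeom_coeff \<alpha> :: 'p zqp fps)"
  define W where "W = (\<lambda>s. \<Prod>i<geom_trunc CARD('p) \<nu> s. frob_quot i :: 'p zqp fps)"
  define B where "B = (\<lambda>s. q_poch 1 (CARD('p) * geom_trunc CARD('p) \<nu> s) :: 'p zqp fps)"
  define D where "D = (\<lambda>s. \<Prod>i<geom_trunc CARD('p) \<nu> s. frob_denom i :: 'p zqp fps)"
  define T where "T = q_poch A \<mu>"
  let ?d = "\<lambda>a. 1 - fps_const a * fps_X :: 'p zqp fps"
    and ?e = "\<lambda>a. 1 - fps_const a * fps_X ^ CARD('p) :: 'p zqp fps"
  have "gauss_cong s (W (Suc s)) (W s)" for s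
    unfolding W_def by (rule gauss_cong_mono[OF frob_quot_trunc_cong]) simp
  then obtain V where V: "\<And>s. gauss_cong s V (W s)" by (rule gauss_cong_limit) blast
  have W0: "fps_nth (W s) 0 = 1" for s by (simp add: W_def fps_nth_prod_0)
  have D0: "fps_nth (D s) 0 = 1" for s by (simp add: D_def fps_nth_prod_0)
  have WD: "W s * D s = B s" for s unfolding W_def D_def B_def by (rule frob_quot_prod_mult)
  have V0: "fps_nth V 0 = 1"
  proof -
    have "fps_const (fps_nth V 0) = (1 :: 'p zqp fps)"
    proof (rule gauss_cong_eqI)
      fix s
      show "gauss_cong s (fps_const (fps_nth V 0)) 1"
        using V[of s] W0[of s] gauss_cong_const[of s "fps_nth V 0" 1] unfolding gauss_cong_def
        by (metis fps_const_1_eq_1 fps_sub_nth)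
    qed
    then have "fps_nth (fps_const (fps_nth V 0)) 0 = fps_nth (1 :: 'p zqp fps) 0"
      by (rule arg_cong)
    then show ?thesis by simp
  qed
  have T0: "fps_nth T 0 = 1" by (simp add: T_def)
  have Q: "Q = A * zqp_q ^ \<mu>" unfolding Q_def A_def by (rule zqp_frob_q_power(2)[OF assms])
  \<comment> \<open>The equation of \<open>W s\<close> has C = q^(p M_s) in place of Q. As C tends
    to Q and \<open>W s\<close> to V, it holds in the limit.\<close>
  have \<sigma>V: "sigma_q V * (?d 1 * ?e Q) = V * (?d Q * ?e 1)"
  proof (rule gauss_cong_eqI)
    fix s
    define C where "C = (zqp_q ^ (CARD('p) * geom_trunc CARD('p) \<nu> s) :: 'p zqp)"
    have C: "gauss_cong s (fps_const Q) (fps_const C)"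
      unfolding Q_def A_def C_def by (rule zqp_frob_q_power(1)[OF assms])
    have "gauss_cong s (sigma_q V * (?d 1 * ?e Q)) (sigma_q (W s) * (?d 1 * ?e C))"
      by (intro gauss_cong_mult gauss_cong_diff gauss_cong_refl gauss_cong_sigma_q V C)
    also have "sigma_q (W s) * (?d 1 * ?e C) = W s * (?d C * ?e 1)"
      using sigma_frob_quot_prod[of "geom_trunc CARD('p) \<nu> s", where 'p='p] by (simp add: W_def C_def)
    also have "gauss_cong s \<dots> (V * (?d Q * ?e 1))"
      by (rule gauss_cong_sym)
        (intro gauss_cong_mult gauss_cong_diff gauss_cong_refl V C)
    finally show "gauss_cong s (sigma_q V * (?d 1 * ?e Q)) (V * (?d Q * ?e 1))" .
  qed
  have \<sigma>T: "sigma_q T * ?d A = T * ?d Q"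
    unfolding T_def Q by (rule sigma_q_poch)
  have c: "?d A * c = ?d 1"
    using hypergeom_coeff_eq[of \<alpha>, where 'p='p] by (simp add: A_def c_def)
  \<comment> \<open>Apply Frobenius to \<open>c\<close>; the instance with second factor 1 evaluates
    the right-hand side 1 - z.\<close>
  have Fc: "?e Q * frob_q c = ?e 1"
    using arg_cong[OF c, of frob_q] frob_q_shifted_mult[of A c] frob_q_shifted_mult[of 1 "1 :: 'p zqp fps"]
    by (simp add: Q_def zqp_frob_hom(4))
  show ?thesis
    unfolding hypergeom_op_conv c_def[symmetric]
  proof (rule strong_frobenius_order_1)
    obtain P where P: "T = fps_of_poly P" using q_poch_poly T_def by blast
    have "\<exists>P. B s = fps_of_poly P" for s unfolding B_def by (rule q_poch_poly)
    then obtain PB where PB: "\<And>s. B s = fps_of_poly (PB s)" by metis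
    have "\<exists>P. D s = fps_of_poly P" for s unfolding D_def by (rule frob_denom_prod_poly)
    then obtain PD where PD: "\<And>s. D s = fps_of_poly (PD s)" by metis
    have "- c * ?d A = fps_of_poly ([:-1, 1:])"
      using c by (simp add: mult.commute fps_of_poly_pCons)
    moreover have "?d A = fps_of_poly [:1, - A:]"
      by (simp add: fps_of_poly_pCons)
    ultimately have "- c \<in> zqp_poly_local" by (rule zqp_poly_localI) simp
    then show "- c \<in> E_ring" using zqp_poly_local_subset_E_ring by blast
    \<comment> \<open>The approximants T / \<open>W s\<close> are the polynomial fractions T
      \<open>D s\<close> / \<open>B s\<close>.\<close>
    show "T * fps_inv1 V \<in> E_ring"
    proof (rule E_ringI)
      fix s
      have "T * fps_inv1 (W s) * (W s * D s) = T * D s"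
        by (metis fps_inv1(2)[OF W0] mult.assoc mult_1_right)
      then have "T * fps_inv1 (W s) * B s = fps_of_poly (P * PD s)"
        by (simp only: WD) (simp only: P PD fps_of_poly_mult)
      then show "T * fps_inv1 (W s) \<in> zqp_poly_local"
        using PB by (rule zqp_poly_localI) (simp add: B_def)
      show "gauss_cong s (T * fps_inv1 V) (T * fps_inv1 (W s))"
        by (intro gauss_cong_mult gauss_cong_refl gauss_cong_inv1 V V0 W0)
    qed
    \<comment> \<open>Here the approximants are \<open>B s\<close> / (T \<open>D s\<close>).\<close>
    show "V * fps_inv1 T \<in> E_ring"
    proof (rule E_ringI)
      fix s
      have "W s * fps_inv1 T * (T * D s) = W s * D s"
        by (metis fps_inv1(2)[OF T0] mult.assoc mult_1_right)
      then have "W s * fps_inv1 T * (T * D s) = fps_of_poly (PB s)"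
        by (simp add: WD PB)
      moreover have "T * D s = fps_of_poly (P * PD s)" by (simp add: P PD fps_of_poly_mult)
      ultimately show "W s * fps_inv1 T \<in> zqp_poly_local"
        by (rule zqp_poly_localI) (simp add: T0 D0 fps_mult_nth_0)
      show "gauss_cong s (V * fps_inv1 T) (W s * fps_inv1 T)"
        by (intro gauss_cong_mult gauss_cong_refl V)
    qed
    show "T * fps_inv1 V * (V * fps_inv1 T) = 1"
      by (metis fps_inv1 T0 V0 mult.assoc mult_1_left)
    define U where "U = fps_inv1 V"
    have VU: "V * U = 1" using V0 by (simp add: U_def fps_inv1)
    then have \<sigma>VU: "sigma_q V * sigma_q U = 1"
      by (metis sigma_q_simps(1,3))
    \<comment> \<open>The Frobenius equation is proved after multiplication by this common
      denominator, a unit with inverse \<open>I\<close>.\<close>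
    define I where "I = fps_inv1 (?d A * ?e Q * ?d Q)"
    have I: "?d A * ?e Q * ?d Q * I = 1"
      unfolding I_def by (rule fps_inv1) (simp add: fps_mult_nth_0)
    have "sigma_q (T * U) * frob_q c * (?d A * ?e Q * ?d Q) =
        (sigma_q T * ?d A) * (?e Q * frob_q c) * ?d Q * sigma_q U"
      by (simp only: sigma_q_simps(3) mult_ac)
    \<comment> \<open>Inserting V U = 1 supplies the factor V to which \<open>\<sigma>V\<close>
      applies.\<close>
    also have "\<dots> = (T * ?d Q * ?e 1 * ?d Q * sigma_q U) * (V * U)"
      by (simp only: \<sigma>T Fc VU mult_1_right)
    also have "\<dots> = (T * ?d Q * sigma_q U * U) * (V * (?d Q * ?e 1))"
      by (simp only: mult_ac)
    also have "\<dots> = (T * ?d Q * sigma_q U * U) * (sigma_q V * (?d 1 * ?e Q))"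
      by (simp only: \<sigma>V)
    also have "\<dots> = (T * ?d Q * U) * (sigma_q V * sigma_q U) * ?d 1 * ?e Q"
      by (simp only: mult_ac)
    also have "\<dots> = (T * ?d Q * U) * (?d A * c) * ?e Q"
      by (simp only: \<sigma>VU c mult_1_right)
    also have "\<dots> = c * (T * U) * (?d A * ?e Q * ?d Q)"
      by (simp only: mult_ac)
    finally have "sigma_q (T * U) * frob_q c * (?d A * ?e Q * ?d Q) * I =
        c * (T * U) * (?d A * ?e Q * ?d Q) * I" by (rule arg_cong)
    then have "sigma_q (T * U) * frob_q c * (?d A * ?e Q * ?d Q * I) =
        c * (T * U) * (?d A * ?e Q * ?d Q * I)" by (simp only: mult.assoc)
    then show "sigma_q (T * fps_inv1 V) * frob_q c = c * (T * fps_inv1 V)"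
      by (simp only: I mult_1_right U_def)
  qed
qed

theorem theorem4p5:
  fixes a b p :: nat and \<alpha> :: rat
  assumes "p = CARD('p::prime_card)"
    and "a > 0" and "b > 0" and "\<alpha> = of_nat a / of_nat b"
    and "0 < \<alpha>" and "\<alpha> \<le> 1"
    and "[p = 1] (mod b)"
  shows "has_strong_frobenius_structure
    (hypergeom_op \<alpha> :: 'p zqp fps \<Rightarrow> 'p zqp fps) 1"
proof -
  have p: "p > 1" using prime_CARD_gt_1[where 'p='p] assms(1) by simp
  have "b dvd p - 1"
    using assms(7) p by (simp add: cong_altdef_nat cong_sym_eq)
  then obtain m where m: "p - 1 = b * m" by (elim dvdE)
  with p have "m > 0" by (cases m) auto
  have pm: "(of_nat p - 1 :: rat) = of_nat b * of_nat m"
    using m p by (metis of_nat_1 of_nat_diff of_nat_mult less_imp_le)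
  have "(of_nat a :: rat) \<le> of_nat b"
    using assms(6) \<open>b > 0\<close> unfolding assms(4) by (simp only: divide_le_eq_1_pos of_nat_0_less_iff)
  then have "a \<le> b" by (simp only: of_nat_le_iff)
  then have "a * m \<le> p - 1" unfolding m by simp
  \<comment> \<open>Here \<mu> = a m = (p - 1)\<alpha> and \<nu> = p - 1 - \<mu>; the bound from
    \<alpha> \<le> 1 makes the natural subtraction exact.\<close>
  then have "a * m + (p - 1 - a * m) + 1 = CARD('p)" using p assms(1) by simp
  moreover have "a * m > 0" using assms(2) \<open>m > 0\<close> by simp
  moreover have "\<alpha> = of_nat (a * m) / (of_nat CARD('p) - 1)"
    using assms(4) \<open>m > 0\<close> by (simp add: pm flip: assms(1))
  ultimately show ?thesis by (rule hypergeom_strong_frobenius)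
qed

end
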